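(* Let $\tau$ be an infinite cardinal and $S$ a $\tau$-wide subset of an abelian group $G$. Then: (i) there exists a group homomorphism $\pi:G\to \mathbb{T}^{2^\tau}$ such that $\pi(S)$ is dense in $\mathbb{T}^{2^\tau}$; (ii) if one additionally assumes that $|G|\le 2^{2^\tau}$, then there exists an injective group homomorphism $\pi:G\to \mathbb{T}^{2^\tau}$ such that $\pi(S)$ is dense in $\mathbb{T}^{2^\tau}$.
   Context: $\mathbb{N}$ is the set of positive integers and $\mathbb{T}=\mathbb{R}/\mathbb{Z}$ is the circle group with its usual topology; $\mathbb{T}^{2^\tau}$ carries the product topology. For a subset $X$ of an abelian group, $nX=\{nx:x\in X\}$ and $\langle X\rangle$ is the subgroup generated by $X$. For an infinite cardinal $\tau$, a subset $S$ of an abelian group $G$ is $\tau$-wide if $nS\setminus\langle S'\rangle\neq\emptyset$ for every $n\in\mathbb{N}$ and each $S'\subseteq S$ with $|S'|<\tau$. *)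

theory Defs
  imports "HOL-Analysis.Analysis" "HOL-Algebra.Product_Groups"
begin

unbundle cardinal_syntax

no_notation eq_closure_of (\<open>closure'_of\<index>\<close>)

text \<open>
  Abelian groups are written multiplicatively, as in HOL-Algebra, so \<open>n x\<close> is
  \<open>x [^]\<^bsub>G\<^esub> n\<close>. A cardinal is a cardinal order, so \<open>|S'| < \<tau>\<close> is
  \<open>|S'| <o \<tau>\<close> and infinite cardinals are those satisfying \<open>Cinfinite\<close>.
\<close>

definition wide :: "('a, 'm) monoid_scheme \<Rightarrow> 'k rel \<Rightarrow> 'a set \<Rightarrow> bool" where
  "wide G \<tau> S \<longleftrightarrow> S \<subseteq> carrier G \<and>
     (\<forall>n::nat. n \<ge> 1 \<longrightarrow> (\<forall>S'. S' \<subseteq> S \<longrightarrow> |S'| <o \<tau> \<longrightarrow>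
        (\<lambda>x. x [^]\<^bsub>G\<^esub> n) ` S - generate G S' \<noteq> {}))"

definition real_group :: "real monoid" where
  "real_group = \<lparr>carrier = UNIV, monoid.mult = (+), one = 0\<rparr>"

definition circle_group :: "real set monoid" where
  "circle_group = real_group Mod \<int>"

text \<open>
  The points of the circle are cosets of \<open>\<int>\<close>, so the preimage of a set \<open>U\<close> of points under
  the projection from the reals is \<open>\<Union>U\<close>.
\<close>

definition circle_topology :: "real set topology" where
  "circle_topology = topology (\<lambda>U. U \<subseteq> carrier circle_group \<and> open (\<Union>U))"

lemma real_group_sel [simp]:
  "carrier real_group = UNIV" "x \<otimes>\<^bsub>real_group\<^esub> y = x + y" "\<one>\<^bsub>real_group\<^esub> = 0"
  by (simp_all add: real_group_def)

lemma comm_group_real_group: "comm_group real_group"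
proof (rule comm_groupI; simp)
  show "\<exists>y. y + x = 0" for x :: real
    by (rule exI[of _ "- x"]) simp
qed

lemma m_inv_real_group: "inv\<^bsub>real_group\<^esub> x = - x"
proof -
  interpret comm_group real_group by (rule comm_group_real_group)
  show ?thesis by (rule inv_equality) auto
qed

lemma normal_Ints_real_group: "\<int> \<lhd> real_group"
proof -
  interpret comm_group real_group by (rule comm_group_real_group)
  have "subgroup \<int> real_group"
    by (rule subgroupI) (auto simp: m_inv_real_group intro: Ints_add)
  then show ?thesis by (rule subgroup_imp_normal)
qed

lemma comm_group_circle_group: "comm_group circle_group"
  unfolding circle_group_def
  by (rule comm_group.abelian_FactGroup[OF comm_group_real_group])
    (rule normal_imp_subgroup[OF normal_Ints_real_group])

lemma Ints_rcoset: "\<int> #>\<^bsub>real_group\<^esub> x = {y. y - x \<in> \<int>}"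
proof -
  have "y \<in> (\<Union>h\<in>\<int>. {h + x})" if "y - x \<in> \<int>" for y
    using that by (intro UN_I[of "y - x"]) auto
  then show ?thesis by (auto simp: r_coset_def)
qed

lemma carrier_circle_group:
  "carrier circle_group = range (\<lambda>x. \<int> #>\<^bsub>real_group\<^esub> x)"
  by (auto simp: circle_group_def FactGroup_def RCOSETS_def)

lemma circle_eqI:
  assumes "A \<in> carrier circle_group" "B \<in> carrier circle_group" "x \<in> A" "x \<in> B"
  shows "A = B"
proof -
  interpret comm_group real_group by (rule comm_group_real_group)
  show ?thesis
    using assms rcos_disjoint[OF normal_imp_subgroup[OF normal_Ints_real_group]]
    by (auto simp: circle_group_def FactGroup_def pairwise_def disjnt_def)
qed

lemma openin_circle_topology:
  "openin circle_topology U \<longleftrightarrow> U \<subseteq> carrier circle_group \<and> open (\<Union>U)"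
proof -
  have "istopology (\<lambda>U. U \<subseteq> carrier circle_group \<and> open (\<Union>U))"
    unfolding istopology_def
  proof (intro conjI allI impI)
    fix U V
    assume U: "U \<subseteq> carrier circle_group \<and> open (\<Union>U)"
      and V: "V \<subseteq> carrier circle_group \<and> open (\<Union>V)"
    have "\<Union>(U \<inter> V) = \<Union>U \<inter> \<Union>V"
    proof
      show "\<Union>U \<inter> \<Union>V \<subseteq> \<Union>(U \<inter> V)"
      proof
        fix x assume "x \<in> \<Union>U \<inter> \<Union>V"
        then obtain A B where *: "A \<in> U" "B \<in> V" "x \<in> A" "x \<in> B" by auto
        then have "A = B" using U V by (intro circle_eqI) auto
        then show "x \<in> \<Union>(U \<inter> V)" using * by auto
      qed
    qed auto
    then show "open (\<Union>(U \<inter> V))" using U V by (auto intro: open_Int)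
    show "U \<inter> V \<subseteq> carrier circle_group" using U by auto
  next
    fix K assume K: "\<forall>U\<in>K. U \<subseteq> carrier circle_group \<and> open (\<Union>U)"
    then show "\<Union>K \<subseteq> carrier circle_group" by auto
    have "\<Union>(\<Union>K) = (\<Union>U\<in>K. \<Union>U)" by auto
    then show "open (\<Union>(\<Union>K))" using K by auto
  qed
  then show ?thesis by (simp add: circle_topology_def)
qed

lemma topspace_circle_topology: "topspace circle_topology = carrier circle_group"
proof -
  have "\<Union>(carrier circle_group) = UNIV"
    by (auto simp: carrier_circle_group Ints_rcoset)
  then have "openin circle_topology (carrier circle_group)"
    by (simp add: openin_circle_topology)
  then show ?thesis
    by (metis openin_circle_topology openin_subset openin_topspace subset_antisym)
qed

lemma quotient_map_circle:
  "quotient_map euclideanreal circle_topology (\<lambda>x. \<int> #>\<^bsub>real_group\<^esub> x)"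
proof -
  have "{x. \<int> #>\<^bsub>real_group\<^esub> x \<in> U} = \<Union>U" if U: "U \<subseteq> carrier circle_group" for U
  proof
    show "{x. \<int> #>\<^bsub>real_group\<^esub> x \<in> U} \<subseteq> \<Union>U"
      by (auto simp: Ints_rcoset)
  next
    show "\<Union>U \<subseteq> {x. \<int> #>\<^bsub>real_group\<^esub> x \<in> U}"
    proof
      fix x assume "x \<in> \<Union>U"
      then obtain A where A: "A \<in> U" "x \<in> A" by auto
      have "\<int> #>\<^bsub>real_group\<^esub> x = A"
        by (rule circle_eqI[of _ _ x])
          (use A U in \<open>auto simp: carrier_circle_group\<close>, auto simp: Ints_rcoset)
      then show "x \<in> {x. \<int> #>\<^bsub>real_group\<^esub> x \<in> U}" using A by simp
    qed
  qed
  then show ?thesis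
    unfolding quotient_map_def topspace_circle_topology
    by (auto simp: openin_circle_topology carrier_circle_group)
qed

text \<open>
  The power \<open>\<T>\<^sup>I\<close> for an index set \<open>I\<close>, as a group and as a topological space; both have
  the underlying set \<open>I \<rightarrow>\<^sub>E carrier circle_group\<close>.
\<close>

definition torus_group :: "'i set \<Rightarrow> ('i \<Rightarrow> real set) monoid" where
  "torus_group I = product_group I (\<lambda>_. circle_group)"

definition torus_topology :: "'i set \<Rightarrow> ('i \<Rightarrow> real set) topology" where
  "torus_topology I = product_topology (\<lambda>_. circle_topology) I"

lemma topspace_torus_topology: "topspace (torus_topology I) = carrier (torus_group I)"
  by (simp add: torus_topology_def torus_group_def topspace_circle_topology)

definition dense_in :: "'a topology \<Rightarrow> 'a set \<Rightarrow> bool" where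
  "dense_in T D \<longleftrightarrow> D \<subseteq> topspace T \<and> T closure_of D = topspace T"

text \<open>
  For a cardinal order \<open>\<tau>\<close>, the set \<open>Field (ctwo ^c \<tau>)\<close> is the set of all maps from
  \<open>Field \<tau>\<close> to \<open>bool\<close> (with value \<open>undefined\<close> elsewhere); it serves as the index set \<open>2\<^sup>\<tau>\<close>.
\<close>

lemma Field_ctwo_cexp: "Field (ctwo ^c \<tau>) = Func (Field \<tau>) (UNIV :: bool set)"
  by (simp add: cexp_def ctwo_def card_of_card_order_on Field_card_of)

abbreviation two_pow :: "'k rel \<Rightarrow> ('k \<Rightarrow> bool) set" where
  "two_pow \<tau> \<equiv> Field (ctwo ^c \<tau>)"

end

(*
  Choose elements x_a of S, for a < tau, together with a list of all pairs (d, m), where d is a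
  rational-valued function on 2^tau depending on finitely many coordinates and m >= 1, each pair
  occurring cofinally often. Wideness gives x_a with m_a! x_a outside <x_b : b < a>, so no
  n <= m_a has n x_a in <x_b : b < a>; since the circle is divisible, every character of
  <x_b : b < a> extends to x_a with a value within 1/m_a of any prescribed target. Doing this
  at each coordinate i in 2^tau with targets d_a(i) gives a dense image, as in the
  Hewitt-Marczewski-Pondiczery theorem. Because pairs recur cofinally, density survives if at
  each coordinate the character is prescribed arbitrarily on an initial segment of the x_b, and it
  does not depend on the values outside H = <x_b : b < tau>.

  For injectivity split 2^tau into two halves. On the first half use this freedom to separate the
  points of H. The common kernel N of these characters meets H trivially, so on the second half
  the characters may be prescribed on H and N simultaneously; on N take a separating family of at
  most 2^tau characters, which exists because |G| <= 2^(2^tau).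
*)
theory Submission
  imports Defs
begin

section \<open>Extension of homomorphisms into divisible groups\<close>

text \<open>The admissible values at x_a of a character already fixed on <x_b : b < a> form a coset
  of the n-torsion of the circle, n being the order of x_a modulo that subgroup (all values if n is
  infinite). The gaps are 1/n, which is why only n > m_a gives precision 1/m_a; m_a! is used because
  every n <= m_a divides it. There are only tau pairs (d, m): finitely many points of 2^tau are told
  apart by finitely many coordinates, so a finite rational table interpolates any finite assignment.
  The obstacle to injectivity is that density uses up the values at the x_b. An element of H,
  however, lies in <x_b : b < a> for some a < tau, so making one coordinate nontrivial at it costs
  only an initial segment. A basic open set looks at finitely many coordinates, so their cutoffs
  have a maximum, and a recurring pair is met beyond it. The separating family repeats the counting
  one exponential higher: a maximal independent set X generates an essential subgroup, its points
  are labelled by functions on I = 2^tau, and each character is described by a finite window of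
  coordinates in I.\<close>

lemma int_multiples_if_diff_closed:
  fixes S :: "int set"
  assumes zero: "0 \<in> S" and diff: "\<And>a b. a \<in> S \<Longrightarrow> b \<in> S \<Longrightarrow> a - b \<in> S"
  obtains n :: nat where "S = {k. int n dvd k}"
proof (cases "S = {0}")
  case True
  then show thesis by (intro that[of 0]) auto
next
  case False
  have uminus: "- a \<in> S" if "a \<in> S" for a
    using diff[OF zero that] by simp
  have add: "a + b \<in> S" if "a \<in> S" "b \<in> S" for a b
    using diff[OF that(1) uminus[OF that(2)]] by simp
  obtain a where a: "a \<in> S" "a \<noteq> 0"
    using False zero by auto
  then have "\<bar>a\<bar> \<in> S" using uminus by (cases "a \<ge> 0") auto
  then have ex: "\<exists>n::nat. n > 0 \<and> int n \<in> S"
    using a by (intro exI[of _ "nat \<bar>a\<bar>"]) auto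
  define n where "n = (LEAST n::nat. n > 0 \<and> int n \<in> S)"
  have n: "n > 0" "int n \<in> S"
    using LeastI_ex[OF ex] by (auto simp: n_def)
  have least: "n \<le> m" if "m > 0" "int m \<in> S" for m
    unfolding n_def using that by (intro Least_le) auto
  have "int n * int q \<in> S" for q
    by (induction q) (auto simp: zero algebra_simps intro: add n)
  then have mult: "int n * q \<in> S" for q
    using uminus by (cases q rule: int_cases2) fastforce+
  have "int n dvd k" if "k \<in> S" for k
  proof -
    have "k mod int n \<in> S"
      using diff[OF that mult[of "k div int n"]] by (simp add: minus_mult_div_eq_mod)
    moreover have "k mod int n < int n" using n by simp
    ultimately have "\<not> nat (k mod int n) > 0"
      using least[of "nat (k mod int n)"] by auto
    moreover have "k mod int n \<ge> 0" using n by simp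
    ultimately show ?thesis using n by (auto simp: dvd_eq_mod_eq_0)
  qed
  then have "S = {k. int n dvd k}" using mult by auto
  then show thesis by (rule that)
qed

text \<open>\<open>n\<close> is the order of \<open>x\<close> modulo \<open>K\<close>, with
  \<open>0\<close> standing for infinite order, since \<open>int 0 dvd k\<close> holds for
  \<open>k = 0\<close> alone.\<close>

lemma (in group) power_exponents_in_subgroup:
  assumes K: "subgroup K G" and x: "x \<in> carrier G"
  obtains n :: nat where "\<And>k::int. x [^] k \<in> K \<longleftrightarrow> int n dvd k"
proof -
  have "\<one> \<in> K" using K by (rule subgroup.one_closed)
  moreover have "x [^] (a - b) \<in> K" if "x [^] a \<in> K" "x [^] b \<in> K" for a b :: int
    using that K x by (simp add: int_pow_diff subgroup.m_closed subgroup.m_inv_closed)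
  ultimately obtain n :: nat where "{k. x [^] k \<in> K} = {k. int n dvd k}"
    by (rule_tac int_multiples_if_diff_closed[of "{k::int. x [^] k \<in> K}"]) auto
  then show thesis by (intro that[of n]) auto
qed

lemma (in comm_group) generate_Un_subset:
  assumes "subgroup H G" "subgroup K G"
  shows "generate G (H \<union> K) \<subseteq> H <#> K"
proof (rule generate_subgroup_incl)
  have "h \<in> H <#> K" if "h \<in> H" for h
    using that assms subgroup.one_closed[OF assms(2)] subgroup.mem_carrier[OF assms(1)]
    unfolding set_mult_def by force
  moreover have "h \<in> H <#> K" if "h \<in> K" for h
    using that assms subgroup.one_closed[OF assms(1)] subgroup.mem_carrier[OF assms(2)]
    unfolding set_mult_def by force
  ultimately show "H \<union> K \<subseteq> H <#> K" by auto
qed (rule mult_subgroups[OF assms])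

lemma (in comm_group) generate_insert_subset:
  assumes K: "subgroup K G" and x: "x \<in> carrier G"
  shows "generate G (insert x K) \<subseteq> {k \<otimes> x [^] (n::int) | k n. k \<in> K}"
proof -
  have x': "subgroup (generate G {x}) G"
    using x by (intro generate_is_subgroup) auto
  have "generate G (insert x K) \<subseteq> generate G (K \<union> generate G {x})"
    using K subgroup.subset[OF K] x by (intro mono_generate) (auto intro: generate.incl)
  also have "\<dots> \<subseteq> K <#> generate G {x}"
    by (rule generate_Un_subset[OF K x'])
  also have "\<dots> = {k \<otimes> x [^] (n::int) | k n. k \<in> K}"
    unfolding generate_pow[OF x] set_mult_def by blast
  finally show ?thesis .
qed

lemma generate_finite_subset:
  assumes "x \<in> generate G A"
  obtains F where "finite F" "F \<subseteq> A" "x \<in> generate G F"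
proof -
  have mono: "generate G E \<subseteq> generate G F" if "E \<subseteq> F" for E F
  proof
    fix y assume "y \<in> generate G E"
    then show "y \<in> generate G F"
      by induction (use that in \<open>auto intro: generate.intros\<close>)
  qed
  have "\<exists>F. finite F \<and> F \<subseteq> A \<and> x \<in> generate G F"
    using assms
  proof induction
    case one
    show ?case by (intro exI[of _ "{}"]) (auto intro: generate.intros)
  next
    case (incl h)
    then show ?case by (intro exI[of _ "{h}"]) (auto intro: generate.intros)
  next
    case (inv h)
    then show ?case by (intro exI[of _ "{h}"]) (auto intro: generate.intros)
  next
    case (eng h1 h2)
    then obtain F1 F2 where "finite F1" "F1 \<subseteq> A" "h1 \<in> generate G F1"
      "finite F2" "F2 \<subseteq> A" "h2 \<in> generate G F2" by blast
    then show ?case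
      using mono[of F1 "F1 \<union> F2"] mono[of F2 "F1 \<union> F2"]
      by (intro exI[of _ "F1 \<union> F2"]) (auto intro: generate.eng)
  qed
  then show thesis using that by blast
qed

locale divisible_target = G: comm_group G + D: comm_group D
  for G :: "('a, 'm) monoid_scheme" (structure) and D :: "('d, 'n) monoid_scheme" +
  assumes divisible: "\<And>d (n::nat). d \<in> carrier D \<Longrightarrow> n > 0 \<Longrightarrow> \<exists>v \<in> carrier D. v [^]\<^bsub>D\<^esub> n = d"
begin

text \<open>Two pairs with equal first component differ by some \<open>(\<one>, t)\<close>, so the
  condition says that the generated subgroup is the graph of a homomorphism on a subgroup of
  \<open>G\<close>. Allowing arbitrary relations lets values be prescribed on any set.\<close>

definition consistent :: "('a \<times> 'd) set \<Rightarrow> bool" where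
  "consistent \<Gamma> \<longleftrightarrow> \<Gamma> \<subseteq> carrier G \<times> carrier D \<and>
     (\<forall>t. (\<one>, t) \<in> generate (G \<times>\<times> D) \<Gamma> \<longrightarrow> t = \<one>\<^bsub>D\<^esub>)"

sublocale P: comm_group "G \<times>\<times> D"
proof -
  interpret group "G \<times>\<times> D"
    by (intro DirProd_group G.group_axioms D.group_axioms)
  show "comm_group (G \<times>\<times> D)"
    by (rule group_comm_groupI) (auto simp: G.m_comm D.m_comm)
qed

lemma P_int_pow [simp]:
  assumes "g \<in> carrier G" "d \<in> carrier D"
  shows "(g, d) [^]\<^bsub>G \<times>\<times> D\<^esub> (k::int) = (g [^] k, d [^]\<^bsub>D\<^esub> k)"
proof -
  have "fst \<in> hom (G \<times>\<times> D) G" "snd \<in> hom (G \<times>\<times> D) D"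
    by (auto simp: hom_def)
  from this[THEN hom_int_pow, of "(g, d)" k] show ?thesis
    using assms P.group_axioms G.group_axioms D.group_axioms
    by (simp add: prod_eq_iff)
qed

lemma P_inv [simp]:
  assumes "g \<in> carrier G" "d \<in> carrier D"
  shows "inv\<^bsub>G \<times>\<times> D\<^esub> (g, d) = (inv g, inv\<^bsub>D\<^esub> d)"
  using assms by (intro inv_DirProd G.group_axioms D.group_axioms)

lemma consistent_functional:
  assumes M: "consistent M" "subgroup M (G \<times>\<times> D)" and gt: "(g, t) \<in> M" "(g, t') \<in> M"
  shows "t = t'"
proof -
  have c: "g \<in> carrier G" "t \<in> carrier D" "t' \<in> carrier D"
    using M(1) gt by (auto simp: consistent_def)
  have "(g, t) \<otimes>\<^bsub>G \<times>\<times> D\<^esub> inv\<^bsub>G \<times>\<times> D\<^esub> (g, t') \<in> generate (G \<times>\<times> D) M"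
    using gt M(2) by (intro generate.incl subgroup.m_closed subgroup.m_inv_closed)
  then have "t \<otimes>\<^bsub>D\<^esub> inv\<^bsub>D\<^esub> t' = \<one>\<^bsub>D\<^esub>"
    using M(1) c unfolding consistent_def by auto
  then show ?thesis
    using c by (metis D.inv_equality D.inv_inv D.inv_closed)
qed

text \<open>The extension step of Baer's criterion: if \<open>n\<close> is the order of
  \<open>x\<close> modulo the domain of \<open>M\<close>, the only constraint on \<open>v\<close> is
  that its \<open>n\<close>-th power be the value already fixed at \<open>x [^] n\<close>, and
  divisibility solves it.\<close>

lemma consistent_insert:
  assumes M: "consistent M" "subgroup M (G \<times>\<times> D)" and x: "x \<in> carrier G"
  shows "\<exists>v \<in> carrier D. consistent (insert (x, v) M)"
proof -
  have fst_hom: "group_hom (G \<times>\<times> D) G fst"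
    by unfold_locales (auto simp: hom_def)
  then have "subgroup (fst ` M) G"
    by (rule group_hom.subgroup_img_is_subgroup) (rule M(2))
  then obtain n :: nat where n: "\<And>k::int. x [^] k \<in> fst ` M \<longleftrightarrow> int n dvd k"
    using x by (metis G.power_exponents_in_subgroup)
  have M_carrier: "g \<in> carrier G" "t \<in> carrier D" if "(g, t) \<in> M" for g t
    using that M(1) by (auto simp: consistent_def)
  have gen_M: "generate (G \<times>\<times> D) M = M"
    using P.generate_subgroup_incl[OF subset_refl M(2)] by (auto intro: generate.incl)
  note M_fun = consistent_functional[OF M]
  obtain t0 where t0: "(x [^] int n, t0) \<in> M"
    using n[of "int n"] by auto
  \<comment> \<open>For \<open>n = 0\<close> the pair at hand is \<open>(\<one>, t0)\<close>;
    consistency makes \<open>t0\<close> trivial, so \<open>x\<close> is free and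
    \<open>\<one>\<close> serves.\<close>
  obtain v where v: "v \<in> carrier D" "v [^]\<^bsub>D\<^esub> n = t0"
  proof (cases "n = 0")
    case True
    then have "(\<one>, t0) \<in> generate (G \<times>\<times> D) M" using t0 gen_M by simp
    then have "t0 = \<one>\<^bsub>D\<^esub>" using M(1) by (auto simp: consistent_def)
    with True show thesis by (intro that[of "\<one>\<^bsub>D\<^esub>"]) auto
  next
    case False
    then show thesis using divisible[OF M_carrier(2)[OF t0], of n] that by auto
  qed
  have "t = \<one>\<^bsub>D\<^esub>" if t: "(\<one>, t) \<in> generate (G \<times>\<times> D) (insert (x, v) M)" for t
  proof -
    have "(x, v) \<in> carrier (G \<times>\<times> D)" using x v by simp
    from subsetD[OF P.generate_insert_subset[OF M(2) this] t] obtain g s and k :: int where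
      *: "(g, s) \<in> M" "(\<one>, t) = (g, s) \<otimes>\<^bsub>G \<times>\<times> D\<^esub> (x, v) [^]\<^bsub>G \<times>\<times> D\<^esub> k"
      by (auto simp del: P_int_pow mult_DirProd)
    have gs: "g \<in> carrier G" "s \<in> carrier D" using M_carrier[OF *(1)] by auto
    have eqs: "g \<otimes> x [^] k = \<one>" "t = s \<otimes>\<^bsub>D\<^esub> v [^]\<^bsub>D\<^esub> k"
      using *(2) x v by auto
    \<comment> \<open>A relation \<open>g \<otimes> x [^] k = \<one>\<close> puts
      \<open>x [^] k\<close> in the domain with value the inverse of \<open>s\<close>. As
      \<open>k\<close> is a multiple of \<open>n\<close>, that value is also a power of
      \<open>t0\<close>, namely the \<open>k\<close>-th power of \<open>v\<close>.\<close>
    have "inv\<^bsub>G \<times>\<times> D\<^esub> (g, s) \<in> M"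
      using *(1) M(2) by (intro subgroup.m_inv_closed)
    moreover have "inv g = x [^] k"
      using gs x eqs(1) by (metis G.inv_equality G.m_comm G.int_pow_closed)
    ultimately have inv_mem: "(x [^] k, inv\<^bsub>D\<^esub> s) \<in> M"
      using gs by simp
    then have "x [^] k \<in> fst ` M" by force
    then obtain q where k: "k = int n * q"
      using n by (auto elim: dvdE)
    have "v [^]\<^bsub>D\<^esub> int n = t0" using v by (simp add: int_pow_int)
    then have "t0 [^]\<^bsub>D\<^esub> q = v [^]\<^bsub>D\<^esub> k"
      using D.int_pow_pow[OF v(1), of "int n" q] k by simp
    moreover have "(x [^] int n) [^] q = x [^] k"
      using G.int_pow_pow[OF x, of "int n" q] k by simp
    moreover have "(x [^] int n, t0) [^]\<^bsub>G \<times>\<times> D\<^esub> q \<in> M"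
      using P.subgroup_int_pow_closed[OF M(2) t0] .
    ultimately have "(x [^] k, v [^]\<^bsub>D\<^esub> k) \<in> M"
      using x M_carrier(2)[OF t0] by simp
    then have "inv\<^bsub>D\<^esub> s = v [^]\<^bsub>D\<^esub> k"
      using M_fun inv_mem by blast
    then show "t = \<one>\<^bsub>D\<^esub>" using eqs gs by (metis D.r_inv)
  qed
  then show ?thesis
    using v x M(1) by (intro bexI[of _ v]) (auto simp: consistent_def)
qed

lemma consistent_generate:
  assumes "consistent \<Gamma>"
  shows "consistent (generate (G \<times>\<times> D) \<Gamma>)"
proof -
  have \<Gamma>: "\<Gamma> \<subseteq> carrier (G \<times>\<times> D)" using assms by (auto simp: consistent_def)
  then have "generate (G \<times>\<times> D) (generate (G \<times>\<times> D) \<Gamma>) \<subseteq> generate (G \<times>\<times> D) \<Gamma>"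
    by (intro P.generate_subgroup_incl subset_refl P.generate_is_subgroup)
  then show ?thesis
    using assms P.generate_incl[OF \<Gamma>] unfolding consistent_def by auto
qed

text \<open>A generated element involves finitely many pairs, and these already lie in one member of
  the chain.\<close>

lemma consistent_Union_chain:
  assumes chain: "subset.chain {\<Gamma>. consistent \<Gamma>} \<C>"
  shows "consistent (\<Union>\<C>)"
  unfolding consistent_def
proof (intro conjI allI impI)
  show "\<Union>\<C> \<subseteq> carrier G \<times> carrier D"
    using chain by (auto simp: subset_chain_def consistent_def)
  fix t assume "(\<one>, t) \<in> generate (G \<times>\<times> D) (\<Union>\<C>)"
  then obtain F where F: "finite F" "F \<subseteq> \<Union>\<C>" "(\<one>, t) \<in> generate (G \<times>\<times> D) F"
    by (rule generate_finite_subset)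
  show "t = \<one>\<^bsub>D\<^esub>"
  proof (cases "\<C> = {}")
    case True
    then have "F = {}" using F(2) by auto
    then show ?thesis using F(3) by (auto simp: P.generate_empty)
  next
    case False
    then obtain M where M: "M \<in> \<C>" "F \<subseteq> M"
      using finite_subset_Union_chain[OF F(1,2) False chain] by auto
    have "consistent M" using M chain by (auto simp: subset_chain_def)
    moreover have "(\<one>, t) \<in> generate (G \<times>\<times> D) M"
      using P.mono_generate[OF M(2)] F(3) by auto
    ultimately show ?thesis by (auto simp: consistent_def)
  qed
qed

theorem hom_extending_graph:
  assumes "consistent \<Gamma>"
  obtains \<phi> where "\<phi> \<in> hom G D" "\<And>g t. (g, t) \<in> \<Gamma> \<Longrightarrow> \<phi> g = t"
proof -
  let ?A = "{M. \<Gamma> \<subseteq> M \<and> consistent M}"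
  have "\<exists>M\<in>?A. \<forall>X\<in>?A. M \<subseteq> X \<longrightarrow> X = M"
  proof (rule subset_Zorn_nonempty)
    show "?A \<noteq> {}" using assms by auto
    fix \<C> assume "\<C> \<noteq> {}" "subset.chain ?A \<C>"
    then show "\<Union>\<C> \<in> ?A"
      using consistent_Union_chain[of \<C>] by (auto simp: subset_chain_def)
  qed
  then obtain M where "M \<in> ?A" and max': "\<forall>X\<in>?A. M \<subseteq> X \<longrightarrow> X = M"
    by (rule bexE)
  then have M: "\<Gamma> \<subseteq> M" "consistent M"
    by simp_all
  have max: "X = M" if "\<Gamma> \<subseteq> X" "consistent X" "M \<subseteq> X" for X
    using max' that by simp
  have M_carrier: "M \<subseteq> carrier (G \<times>\<times> D)" using M(2) by (auto simp: consistent_def)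
  have "M \<subseteq> generate (G \<times>\<times> D) M" by (auto intro: generate.incl)
  \<comment> \<open>Generating preserves consistency, so maximality turns \<open>M\<close> into a
    subgroup, hence into a graph; \<open>consistent_insert\<close> then makes it total.\<close>
  then have gen_M: "generate (G \<times>\<times> D) M = M"
    using M by (intro max consistent_generate) auto
  then have sub: "subgroup M (G \<times>\<times> D)"
    using P.generate_is_subgroup[OF M_carrier] by simp
  have total: "\<exists>v. (x, v) \<in> M" if x: "x \<in> carrier G" for x
  proof -
    obtain v where "consistent (insert (x, v) M)"
      using consistent_insert[OF M(2) sub x] by auto
    then have "insert (x, v) M = M" using M(1) by (intro max) auto
    then show ?thesis by auto
  qed
  note M_fun = consistent_functional[OF M(2) sub]
  define \<phi> where "\<phi> x = (SOME v. (x, v) \<in> M)" for x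
  have \<phi>: "(x, \<phi> x) \<in> M" if "x \<in> carrier G" for x
    unfolding \<phi>_def using total[OF that] by (rule someI_ex)
  have "\<phi> \<in> hom G D"
  proof (rule homI)
    show "\<phi> x \<in> carrier D" if "x \<in> carrier G" for x
      using \<phi>[OF that] M_carrier by auto
    show "\<phi> (x \<otimes> y) = \<phi> x \<otimes>\<^bsub>D\<^esub> \<phi> y" if xy: "x \<in> carrier G" "y \<in> carrier G" for x y
    proof -
      have "(x, \<phi> x) \<otimes>\<^bsub>G \<times>\<times> D\<^esub> (y, \<phi> y) \<in> M"
        using xy \<phi> sub by (intro subgroup.m_closed) auto
      then show ?thesis using M_fun \<phi>[of "x \<otimes> y"] xy by auto
    qed
  qed
  moreover have "\<phi> g = t" if "(g, t) \<in> \<Gamma>" for g t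
  proof (rule M_fun)
    show gt: "(g, t) \<in> M" using that M(1) by auto
    then show "(g, \<phi> g) \<in> M" using M_carrier by (intro \<phi>) auto
  qed
  ultimately show thesis by (rule that)
qed

end

section \<open>Compactness, gluing and transfinite recursion for homomorphisms\<close>

lemma Well_order_finite_max:
  assumes r: "Well_order r" and F: "finite F" "F \<noteq> {}" "F \<subseteq> Field r"
  obtains m where "m \<in> F" "\<And>a. a \<in> F \<Longrightarrow> (a, m) \<in> r"
proof -
  interpret wo_rel r using r by (simp add: wo_rel_def)
  have "\<exists>m\<in>F. \<forall>a\<in>F. (a, m) \<in> r"
    using F
  proof (induction rule: finite_ne_induct)
    case (singleton a)
    then show ?case using REFL by (auto simp: refl_on_def)
  next
    case (insert a F)
    then obtain m where m: "m \<in> F" "\<forall>b\<in>F. (b, m) \<in> r" by auto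
    show ?case
    proof (cases "(a, m) \<in> r")
      case True
      then show ?thesis using m by auto
    next
      case False
      then have ma: "(m, a) \<in> r" using TOTALS insert.prems m(1) by auto
      then have "(b, a) \<in> r" if "b \<in> F" for b
        using m(2) that TRANS by (meson transD)
      then show ?thesis using REFL insert.prems by (auto simp: refl_on_def)
    qed
  qed
  then show thesis using that by blast
qed

context divisible_target
begin

lemma trivial_hom: "(\<lambda>_. \<one>\<^bsub>D\<^esub>) \<in> hom G D"
  by (auto simp: hom_def)

lemma hom_mult:
  assumes "\<phi> \<in> hom G D" "\<psi> \<in> hom G D"
  shows "(\<lambda>g. \<phi> g \<otimes>\<^bsub>D\<^esub> \<psi> g) \<in> hom G D"
proof (rule homI)
  fix g h assume gh: "g \<in> carrier G" "h \<in> carrier G"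
  then have "\<phi> g \<in> carrier D" "\<phi> h \<in> carrier D" "\<psi> g \<in> carrier D" "\<psi> h \<in> carrier D"
    using assms by (auto intro: hom_in_carrier)
  then show "\<phi> (g \<otimes> h) \<otimes>\<^bsub>D\<^esub> \<psi> (g \<otimes> h) = \<phi> g \<otimes>\<^bsub>D\<^esub> \<psi> g \<otimes>\<^bsub>D\<^esub> (\<phi> h \<otimes>\<^bsub>D\<^esub> \<psi> h)"
    using gh assms by (simp add: hom_mult D.m_ac)
qed (use assms in \<open>auto intro: hom_in_carrier\<close>)

lemma hom_one: "\<phi> \<in> hom G D \<Longrightarrow> \<phi> \<one> = \<one>\<^bsub>D\<^esub>"
  by (rule Group.hom_one[OF _ G.group_axioms D.group_axioms])

lemma hom_power:
  "\<phi> \<in> hom G D \<Longrightarrow> x \<in> carrier G \<Longrightarrow> \<phi> (x [^] (k::int)) = \<phi> x [^]\<^bsub>D\<^esub> k"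
  by (rule hom_int_pow[OF _ _ G.group_axioms D.group_axioms])

lemma subgroup_graph:
  assumes H: "subgroup H G" and f: "f \<in> hom (G\<lparr>carrier := H\<rparr>) D"
  shows "subgroup ((\<lambda>h. (h, f h)) ` H) (G \<times>\<times> D)"
proof -
  interpret H: group "G\<lparr>carrier := H\<rparr>"
    using H G.group_axioms by (rule subgroup.subgroup_is_group)
  interpret f: group_hom "G\<lparr>carrier := H\<rparr>" D f
    by unfold_locales (rule f)
  have f_closed: "f h \<in> carrier D" if "h \<in> H" for h
    using that f.hom_closed by simp
  have f_inv: "f (inv h) = inv\<^bsub>D\<^esub> f h" if "h \<in> H" for h
    using that f.hom_inv[of h] G.m_inv_consistent[OF H that] by simp
  show ?thesis
  proof (rule P.subgroupI)
    show "(\<lambda>h. (h, f h)) ` H \<subseteq> carrier (G \<times>\<times> D)"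
      using f_closed subgroup.subset[OF H] by auto
    show "(\<lambda>h. (h, f h)) ` H \<noteq> {}"
      using subgroup.one_closed[OF H] by auto
  next
    fix a assume "a \<in> (\<lambda>h. (h, f h)) ` H"
    then show "inv\<^bsub>G \<times>\<times> D\<^esub> a \<in> (\<lambda>h. (h, f h)) ` H"
      using f_closed f_inv subgroup.mem_carrier[OF H] subgroup.m_inv_closed[OF H] by force
  next
    fix a b assume "a \<in> (\<lambda>h. (h, f h)) ` H" "b \<in> (\<lambda>h. (h, f h)) ` H"
    then obtain h k where "h \<in> H" "k \<in> H" "a = (h, f h)" "b = (k, f k)" by auto
    then show "a \<otimes>\<^bsub>G \<times>\<times> D\<^esub> b \<in> (\<lambda>h. (h, f h)) ` H"
      using f.hom_mult[of h k] subgroup.m_closed[OF H, of h k]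
      by (intro image_eqI[of _ _ "h \<otimes> k"]) auto
  qed
qed

text \<open>A violation of consistency involves finitely many pairs, and a homomorphism through
  those pairs excludes it, since its graph is a subgroup containing them.\<close>

lemma hom_if_finite_subgraphs:
  assumes \<Gamma>: "\<Gamma> \<subseteq> carrier G \<times> carrier D"
    and fin: "\<And>F. finite F \<Longrightarrow> F \<subseteq> \<Gamma> \<Longrightarrow> \<exists>\<phi>\<in>hom G D. \<forall>(g, t)\<in>F. \<phi> g = t"
  obtains \<phi> where "\<phi> \<in> hom G D" "\<And>g t. (g, t) \<in> \<Gamma> \<Longrightarrow> \<phi> g = t"
proof -
  have "t = \<one>\<^bsub>D\<^esub>" if t: "(\<one>, t) \<in> generate (G \<times>\<times> D) \<Gamma>" for t
  proof -
    obtain F where F: "finite F" "F \<subseteq> \<Gamma>" "(\<one>, t) \<in> generate (G \<times>\<times> D) F"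
      using t by (rule generate_finite_subset)
    obtain \<phi> where \<phi>: "\<phi> \<in> hom G D" "\<forall>(g, t)\<in>F. \<phi> g = t"
      using fin[OF F(1,2)] by auto
    have "subgroup ((\<lambda>g. (g, \<phi> g)) ` carrier G) (G \<times>\<times> D)"
      using \<phi>(1) by (intro subgroup_graph) (auto intro: G.subgroup_self)
    moreover have "F \<subseteq> (\<lambda>g. (g, \<phi> g)) ` carrier G"
      using F(2) \<Gamma> \<phi>(2) by fastforce
    ultimately have "generate (G \<times>\<times> D) F \<subseteq> (\<lambda>g. (g, \<phi> g)) ` carrier G"
      by (intro P.generate_subgroup_incl)
    then show ?thesis using F(3) hom_one[OF \<phi>(1)] by auto
  qed
  then have "consistent \<Gamma>" using \<Gamma> by (auto simp: consistent_def)
  then show thesis using that by (rule hom_extending_graph) auto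
qed

text \<open>The generated subgroup meets the fibre over \<open>\<one>\<close> only through products
  \<open>h \<otimes> k = \<one>\<close>; then \<open>h\<close> is the inverse of \<open>k\<close>,
  lies in both subgroups, and is trivial.\<close>

lemma hom_joint_extension:
  assumes H: "subgroup H G" "f \<in> hom (G\<lparr>carrier := H\<rparr>) D"
    and K: "subgroup K G" "e \<in> hom (G\<lparr>carrier := K\<rparr>) D"
    and disj: "H \<inter> K \<subseteq> {\<one>}"
  obtains \<phi> where "\<phi> \<in> hom G D" "\<And>h. h \<in> H \<Longrightarrow> \<phi> h = f h" "\<And>k. k \<in> K \<Longrightarrow> \<phi> k = e k"
proof -
  let ?f = "(\<lambda>h. (h, f h)) ` H" and ?e = "(\<lambda>k. (k, e k)) ` K"
  have f: "subgroup ?f (G \<times>\<times> D)" and e: "subgroup ?e (G \<times>\<times> D)"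
    using H K by (auto intro: subgroup_graph)
  have one: "f \<one> = \<one>\<^bsub>D\<^esub>" "e \<one> = \<one>\<^bsub>D\<^esub>"
    using subgroup.one_closed[OF f] subgroup.one_closed[OF e] by auto
  have carr: "f h \<in> carrier D" if "h \<in> H" for h
    using that subgroup.subset[OF f] by auto
  have "t = \<one>\<^bsub>D\<^esub>" if "(\<one>, t) \<in> generate (G \<times>\<times> D) (?f \<union> ?e)" for t
  proof -
    have "(\<one>, t) \<in> ?f <#>\<^bsub>G \<times>\<times> D\<^esub> ?e"
      using that P.generate_Un_subset[OF f e] by auto
    then obtain h k where hk: "h \<in> H" "k \<in> K" "h \<otimes> k = \<one>" "t = f h \<otimes>\<^bsub>D\<^esub> e k"
      by (auto simp: set_mult_def)
    have c: "h \<in> carrier G" "k \<in> carrier G"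
      using hk H K by (auto intro: subgroup.mem_carrier)
    have "h = inv k" using hk(3) c by (metis G.inv_equality)
    then have "h \<in> H \<inter> K" using hk subgroup.m_inv_closed[OF K(1)] by auto
    then have "h = \<one>" using disj by auto
    then show ?thesis using hk(3,4) c one by auto
  qed
  then have "consistent (?f \<union> ?e)"
    using subgroup.subset[OF f] subgroup.subset[OF e] by (auto simp: consistent_def)
  then obtain \<phi> where "\<phi> \<in> hom G D" "\<And>g t. (g, t) \<in> ?f \<union> ?e \<Longrightarrow> \<phi> g = t"
    by (rule hom_extending_graph) auto
  then show thesis by (intro that[of \<phi>]) auto
qed

text \<open>All relations between \<open>x\<close> and \<open>K\<close> come from powers of
  \<open>x\<close> lying in \<open>K\<close>. Multiplying a homomorphism by such a
  \<open>\<phi>\<close> shifts its value at \<open>x\<close> by \<open>s\<close> and keeps its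
  values on \<open>K\<close>; later corrections all have this form.\<close>

lemma hom_trivial_on_subgroup:
  assumes K: "subgroup K G" and x: "x \<in> carrier G" and s: "s \<in> carrier D"
    and ks: "\<And>k::int. x [^] k \<in> K \<Longrightarrow> s [^]\<^bsub>D\<^esub> k = \<one>\<^bsub>D\<^esub>"
  obtains \<phi> where "\<phi> \<in> hom G D" "\<And>g. g \<in> K \<Longrightarrow> \<phi> g = \<one>\<^bsub>D\<^esub>" "\<phi> x = s"
proof -
  let ?\<Gamma> = "(\<lambda>g. (g, \<one>\<^bsub>D\<^esub>)) ` K"
  have \<Gamma>: "subgroup ?\<Gamma> (G \<times>\<times> D)"
    using K by (intro subgroup_graph) (auto simp: hom_def)
  have xs: "(x, s) \<in> carrier (G \<times>\<times> D)" using x s by simp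
  have "t = \<one>\<^bsub>D\<^esub>" if t: "(\<one>, t) \<in> generate (G \<times>\<times> D) (insert (x, s) ?\<Gamma>)" for t
  proof -
    obtain g and k :: int where gk: "g \<in> K" "g \<otimes> x [^] k = \<one>" "t = s [^]\<^bsub>D\<^esub> k"
      using subsetD[OF P.generate_insert_subset[OF \<Gamma> xs] t] x s by auto
    have "g \<in> carrier G" using gk(1) K by (rule subgroup.mem_carrier[rotated])
    then have "inv g = x [^] k"
      using gk(2) x by (metis G.inv_equality G.m_comm G.int_pow_closed)
    then have "x [^] k \<in> K" using subgroup.m_inv_closed[OF K gk(1)] by simp
    then show ?thesis using ks gk(3) by simp
  qed
  then have "consistent (insert (x, s) ?\<Gamma>)"
    using subgroup.subset[OF \<Gamma>] x s by (auto simp: consistent_def)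
  then obtain \<phi> where "\<phi> \<in> hom G D" "\<And>g t. (g, t) \<in> insert (x, s) ?\<Gamma> \<Longrightarrow> \<phi> g = t"
    by (rule hom_extending_graph) auto
  then show thesis by (intro that[of \<phi>]) auto
qed

text \<open>Only the values at the points \<open>x b\<close> are carried along, since homomorphisms
  picked at different stages need not agree elsewhere. The values chosen so far are jointly
  realisable by compactness: among finitely many indices the largest supplies a homomorphism correct
  at all of them.\<close>

lemma hom_transfinite_recursion:
  fixes r :: "'k rel" and x :: "'k \<Rightarrow> 'a" and P :: "'k \<Rightarrow> 'd \<Rightarrow> bool"
  assumes r: "Well_order r" and x: "\<And>a. a \<in> Field r \<Longrightarrow> x a \<in> carrier G"
    and step: "\<And>a \<phi>. a \<in> Field r \<Longrightarrow> \<phi> \<in> hom G D \<Longrightarrow> (\<And>b. b \<in> underS r a \<Longrightarrow> P b (\<phi> (x b))) \<Longrightarrow>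
      \<exists>\<psi>\<in>hom G D. (\<forall>b\<in>underS r a. \<psi> (x b) = \<phi> (x b)) \<and> P a (\<psi> (x a))"
  obtains \<phi> where "\<phi> \<in> hom G D" "\<And>a. a \<in> Field r \<Longrightarrow> P a (\<phi> (x a))"
proof -
  \<comment> \<open>The witness inside \<open>Q\<close> realises the new value together with all
    earlier ones, which is what the compactness argument in \<open>realize\<close> feeds on. Outside
    \<open>Field r\<close> the condition is vacuous because the choice principle ranges over the
    whole type.\<close>
  define Q where "Q f a v \<longleftrightarrow> a \<in> Field r \<longrightarrow>
    (\<exists>\<phi>\<in>hom G D. (\<forall>b\<in>underS r a. \<phi> (x b) = f b) \<and> \<phi> (x a) = v \<and> P a v)" for f a v
  have realize: "\<exists>\<phi>\<in>hom G D. \<forall>b\<in>J. \<phi> (x b) = f b"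
    if J: "J \<subseteq> Field r" and Q: "\<And>b. b \<in> J \<Longrightarrow> Q f b (f b)" for J and f :: "'k \<Rightarrow> 'd"
  proof -
    have "\<exists>\<phi>\<in>hom G D. \<forall>(g, t)\<in>F. \<phi> g = t"
      if F: "finite F" "F \<subseteq> (\<lambda>b. (x b, f b)) ` J" for F
    proof -
      obtain E where E: "finite E" "E \<subseteq> J" "F = (\<lambda>b. (x b, f b)) ` E"
        using finite_subset_image[OF F] by auto
      show ?thesis
      proof (cases "E = {}")
        case True
        then show ?thesis using E trivial_hom by auto
      next
        case False
        then obtain m where m: "m \<in> E" "\<And>a. a \<in> E \<Longrightarrow> (a, m) \<in> r"
          using Well_order_finite_max[OF r E(1)] E(2) J by blast
        have "Q f m (f m)" "m \<in> Field r" using m E(2) J Q by auto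
        then obtain \<phi> where \<phi>: "\<phi> \<in> hom G D" "\<forall>b\<in>underS r m. \<phi> (x b) = f b" "\<phi> (x m) = f m"
          by (auto simp: Q_def)
        have "\<phi> (x b) = f b" if "b \<in> E" for b
          using \<phi> m(2)[OF that] by (cases "b = m") (auto simp: underS_def)
        then show ?thesis using \<phi>(1) E(3) by auto
      qed
    qed
    moreover have "(\<lambda>b. (x b, f b)) ` J \<subseteq> carrier G \<times> carrier D"
    proof -
      have "f b \<in> carrier D" if b: "b \<in> J" for b
      proof -
        obtain \<phi> where "\<phi> \<in> hom G D" "\<phi> (x b) = f b"
          using Q[OF b] J b by (auto simp: Q_def)
        then show ?thesis using hom_in_carrier[of \<phi> G D "x b"] x[of b] b J by auto
      qed
      then show ?thesis using J x by auto
    qed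
    ultimately obtain \<phi> where "\<phi> \<in> hom G D" "\<And>g t. (g, t) \<in> (\<lambda>b. (x b, f b)) ` J \<Longrightarrow> \<phi> g = t"
      by (rule_tac hom_if_finite_subgraphs[of "(\<lambda>b. (x b, f b)) ` J"]) auto
    then show ?thesis by (intro bexI[of _ \<phi>]) auto
  qed
  have underS_iff: "b \<in> underS r a \<longleftrightarrow> (b, a) \<in> r - Id" for a b
    by (auto simp: underS_def)
  have "\<exists>f. \<forall>a. Q f a (f a)"
  proof (rule dependent_wf_choice)
    show "wf (r - Id)" using r by (simp add: well_order_on_def)
    show "Q f a v = Q g a v" if "\<And>b. (b, a) \<in> r - Id \<Longrightarrow> f b = g b" for f g a v
      using that by (simp add: Q_def underS_iff)
    show "\<exists>v. Q f a v" if Qb: "\<And>b. (b, a) \<in> r - Id \<Longrightarrow> Q f b (f b)" for a f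
    proof (cases "a \<in> Field r")
      case False
      then show ?thesis by (auto simp: Q_def)
    next
      case True
      have under: "underS r a \<subseteq> Field r" by (auto simp: underS_def Field_def)
      then obtain \<phi> where \<phi>: "\<phi> \<in> hom G D" "\<forall>b\<in>underS r a. \<phi> (x b) = f b"
        using realize[of "underS r a" f] Qb by (auto simp: underS_iff)
      have "P b (\<phi> (x b))" if "b \<in> underS r a" for b
        using Qb[of b] that under \<phi>(2) by (auto simp: underS_iff Q_def)
      then obtain \<psi> where "\<psi> \<in> hom G D" "\<forall>b\<in>underS r a. \<psi> (x b) = \<phi> (x b)" "P a (\<psi> (x a))"
        using step[OF True \<phi>(1)] by blast
      then have "Q f a (\<psi> (x a))" using \<phi> by (auto simp: Q_def)
      then show ?thesis by blast
    qed
  qed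
  then obtain f where f: "\<And>a. Q f a (f a)" by blast
  then obtain \<phi> where \<phi>: "\<phi> \<in> hom G D" "\<forall>b\<in>Field r. \<phi> (x b) = f b"
    using realize[of "Field r" f] by auto
  have "P a (\<phi> (x a))" if "a \<in> Field r" for a
    using f[of a] \<phi>(2) that by (auto simp: Q_def)
  then show thesis by (rule that[OF \<phi>(1)])
qed

end

section \<open>Characters into the circle\<close>

definition circle_point :: "real \<Rightarrow> real set" where
  "circle_point x = \<int> #>\<^bsub>real_group\<^esub> x"

lemma circle_point_closed [simp]: "circle_point x \<in> carrier circle_group"
  by (auto simp: circle_point_def carrier_circle_group)

lemma circle_pointE:
  assumes "p \<in> carrier circle_group"
  obtains x where "p = circle_point x"
  using assms by (auto simp: circle_point_def carrier_circle_group)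

lemma circle_point_eq_iff: "circle_point x = circle_point y \<longleftrightarrow> x - y \<in> \<int>"
proof
  assume "circle_point x = circle_point y"
  then have "x \<in> circle_point y" by (auto simp: circle_point_def Ints_rcoset)
  then show "x - y \<in> \<int>" by (auto simp: circle_point_def Ints_rcoset)
next
  assume "x - y \<in> \<int>"
  then have "x \<in> circle_point x" "x \<in> circle_point y"
    by (auto simp: circle_point_def Ints_rcoset)
  then show "circle_point x = circle_point y"
    by (intro circle_eqI[of _ _ x]) auto
qed

lemma circle_point_mult [simp]:
  "circle_point x \<otimes>\<^bsub>circle_group\<^esub> circle_point y = circle_point (x + y)"
  using normal.rcos_sum[OF normal_Ints_real_group, of x y]
  by (simp add: circle_point_def circle_group_def)

lemma circle_point_hom: "circle_point \<in> hom real_group circle_group"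
  by (rule homI) auto

lemma circle_point_eq_one_iff: "circle_point x = \<one>\<^bsub>circle_group\<^esub> \<longleftrightarrow> x \<in> \<int>"
proof -
  interpret C: comm_group circle_group by (rule comm_group_circle_group)
  interpret R: comm_group real_group by (rule comm_group_real_group)
  have "circle_point 0 = \<one>\<^bsub>circle_group\<^esub>"
    using hom_one[OF circle_point_hom R.group_axioms C.group_axioms] by simp
  then show ?thesis using circle_point_eq_iff[of x 0] by simp
qed

lemma circle_point_nat_pow [simp]:
  "circle_point x [^]\<^bsub>circle_group\<^esub> (n::nat) = circle_point (real n * x)"
proof -
  interpret C: comm_group circle_group by (rule comm_group_circle_group)
  show ?thesis
  proof (induction n)
    case 0
    then show ?case using circle_point_eq_one_iff[of 0] by simp
  qed (simp add: algebra_simps)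
qed

lemma circle_point_int_pow [simp]:
  "circle_point x [^]\<^bsub>circle_group\<^esub> (k::int) = circle_point (of_int k * x)"
proof -
  interpret C: comm_group circle_group by (rule comm_group_circle_group)
  have neg: "inv\<^bsub>circle_group\<^esub> (circle_point y) = circle_point (- y)" for y
    by (rule C.inv_equality) (simp_all add: circle_point_eq_one_iff)
  show ?thesis
    by (cases k rule: int_cases2) (simp_all add: C.int_pow_neg int_pow_int neg)
qed

lemma divisible_target_circle:
  assumes "comm_group G"
  shows "divisible_target G circle_group"
proof -
  have "\<exists>v\<in>carrier circle_group. v [^]\<^bsub>circle_group\<^esub> n = d"
    if d: "d \<in> carrier circle_group" and n: "n > 0" for d and n :: nat
  proof -
    obtain x where "d = circle_point x" using d by (rule circle_pointE)
    then show ?thesis using n by (intro bexI[of _ "circle_point (x / n)"]) auto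
  qed
  then show ?thesis
    using assms comm_group_circle_group
    by (auto simp: divisible_target_def divisible_target_axioms_def)
qed

text \<open>Supplies a circle point of order exactly \<open>n\<close>: an irrational number for
  infinite order, coded by \<open>n = 0\<close>, and \<open>1 / n\<close> otherwise. A character
  sending an element of order \<open>n\<close> there is faithful on the cyclic group it
  generates.\<close>

lemma real_of_order_mod_Ints:
  fixes n :: nat
  obtains t :: real where "\<And>k::int. of_int k * t \<in> \<int> \<longleftrightarrow> int n dvd k"
proof (cases "n = 0")
  case True
  have "\<rat> \<noteq> (UNIV :: real set)"
    using countable_rat[where ?'a = real] uncountable_UNIV_real by metis
  then obtain t :: real where t: "t \<notin> \<rat>" by auto
  have "k = 0" if "of_int k * t \<in> \<int>" for k
  proof (rule ccontr)
    assume "k \<noteq> 0"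
    then have "t = (of_int k * t) / of_int k" by simp
    also have "\<dots> \<in> \<rat>" using that Ints_subset_Rats by (intro Rats_divide) auto
    finally show False using t by simp
  qed
  then show thesis using True by (intro that[of t]) auto
next
  case False
  have "int n dvd k" if k: "of_int k * (1 / real n) \<in> \<int>" for k
  proof -
    obtain j :: int where "of_int k * (1 / real n) = of_int j" using k by (auto elim: Ints_cases)
    then have "real_of_int k = of_int (j * int n)" using False by (simp add: field_simps)
    then show ?thesis unfolding of_int_eq_iff by simp
  qed
  then show thesis using False by (intro that[of "1 / real n"]) (auto elim!: dvdE)
qed

text \<open>\<open>\<phi>\<close> is multiplied by a character \<open>\<rho>\<close> trivial on
  \<open>K\<close>, whose value at \<open>x\<close> may be any circle point killed by the order
  \<open>n\<close> of \<open>x\<close> modulo \<open>K\<close>. Such points are spaced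
  \<open>1 / n\<close> apart, and the factorial hypothesis makes \<open>n\<close> infinite or larger
  than \<open>m\<close>.\<close>

lemma (in comm_group) hom_circle_approximating:
  assumes K: "subgroup K G" and x: "x \<in> carrier G" and m: "m > 0"
    and xm: "x [^] (fact m :: nat) \<notin> K" and \<phi>: "\<phi> \<in> hom G circle_group"
  obtains \<psi> e where "\<psi> \<in> hom G circle_group" "\<And>g. g \<in> K \<Longrightarrow> \<psi> g = \<phi> g"
    "\<bar>e\<bar> \<le> 1 / real m" "\<psi> x = circle_point (t + e)"
proof -
  interpret divisible_target G circle_group
    by (rule divisible_target_circle) (rule comm_group_axioms)
  obtain w where w: "\<phi> x = circle_point w"
    using hom_in_carrier[OF \<phi> x] by (rule circle_pointE)
  obtain n :: nat where n: "\<And>k::int. x [^] k \<in> K \<longleftrightarrow> int n dvd k"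
    using power_exponents_in_subgroup[OF K x] by blast
  have "\<not> n dvd fact m"
    using n[of "int (fact m)"] xm unfolding int_pow_int int_dvd_int_iff by simp
  \<comment> \<open>Each positive \<open>n \<le> m\<close> divides \<open>fact m\<close>; infinite
    order (\<open>n = 0\<close>) and orders above \<open>m\<close> remain.\<close>
  then have nm: "n = 0 \<or> n > m"
    using dvd_fact[of n m] by (cases "n = 0") force+
  \<comment> \<open>\<open>s\<close> is the correction added to \<open>w\<close>: the multiple of
    \<open>1 / n\<close> just below \<open>t - w\<close>, or \<open>t - w\<close> itself if
    \<open>n = 0\<close>.\<close>
  obtain s where s: "of_int (int n) * s \<in> \<int>" "\<bar>s - (t - w)\<bar> \<le> 1 / real m"
  proof (cases "n = 0")
    case True
    then show thesis using m by (intro that[of "t - w"]) auto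
  next
    case False
    then have nm: "n > m" using nm by simp
    let ?s = "of_int \<lfloor>n * (t - w)\<rfloor> / real n"
    have "?s - (t - w) = (of_int \<lfloor>n * (t - w)\<rfloor> - n * (t - w)) / real n"
      using False by (simp add: diff_divide_distrib)
    then have "\<bar>?s - (t - w)\<bar> = \<bar>of_int \<lfloor>n * (t - w)\<rfloor> - n * (t - w)\<bar> / real n"
      by (simp add: abs_divide)
    also have "\<dots> \<le> 1 / real n"
      by (intro divide_right_mono) linarith+
    also have "\<dots> \<le> 1 / real m" using nm m by (intro divide_left_mono) auto
    finally show thesis using False by (intro that[of ?s]) auto
  qed
  have ks: "circle_point s [^]\<^bsub>circle_group\<^esub> k = \<one>\<^bsub>circle_group\<^esub>" if k: "x [^] k \<in> K" for k :: int
  proof -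
    obtain q where "k = int n * q" using n k by (auto elim: dvdE)
    then have "of_int k * s = of_int q * (of_int (int n) * s)" by simp
    also have "\<dots> \<in> \<int>" by (rule Ints_mult[OF Ints_of_int s(1)])
    finally show ?thesis by (simp add: circle_point_eq_one_iff)
  qed
  obtain \<rho> where \<rho>: "\<rho> \<in> hom G circle_group" "\<And>g. g \<in> K \<Longrightarrow> \<rho> g = \<one>\<^bsub>circle_group\<^esub>"
    "\<rho> x = circle_point s"
    using hom_trivial_on_subgroup[OF K x circle_point_closed ks] by blast
  have K_carrier: "g \<in> carrier G" if "g \<in> K" for g
    using K that by (rule subgroup.mem_carrier)
  show thesis
  proof (rule that[of "\<lambda>g. \<phi> g \<otimes>\<^bsub>circle_group\<^esub> \<rho> g" "w + s - t"])
    show "(\<lambda>g. \<phi> g \<otimes>\<^bsub>circle_group\<^esub> \<rho> g) \<in> hom G circle_group"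
      using \<phi> \<rho>(1) by (rule hom_mult)
    show "\<phi> g \<otimes>\<^bsub>circle_group\<^esub> \<rho> g = \<phi> g" if "g \<in> K" for g
      using that \<rho>(2) hom_in_carrier[OF \<phi>] K_carrier by simp
    show "\<bar>w + s - t\<bar> \<le> 1 / real m" using s(2) by (simp add: algebra_simps)
    show "\<phi> x \<otimes>\<^bsub>circle_group\<^esub> \<rho> x = circle_point (t + (w + s - t))"
      using w \<rho>(3) by simp
  qed
qed

lemma (in comm_group) hom_torus:
  assumes "\<And>i. i \<in> I \<Longrightarrow> \<phi> i \<in> hom G circle_group"
  shows "(\<lambda>g. \<lambda>i\<in>I. \<phi> i g) \<in> hom G (torus_group I)"
proof (rule homI)
  show "(\<lambda>i\<in>I. \<phi> i g) \<in> carrier (torus_group I)" if "g \<in> carrier G" for g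
    using that assms by (auto simp: torus_group_def intro: hom_in_carrier)
  show "(\<lambda>i\<in>I. \<phi> i (g \<otimes> h)) = (\<lambda>i\<in>I. \<phi> i g) \<otimes>\<^bsub>torus_group I\<^esub> (\<lambda>i\<in>I. \<phi> i h)"
    if "g \<in> carrier G" "h \<in> carrier G" for g h
    using that hom_mult[OF assms] by (simp add: torus_group_def cong: restrict_cong)
qed

lemma openin_circle_point:
  assumes "openin circle_topology U" "circle_point t \<in> U"
  obtains \<epsilon> where "\<epsilon> > 0" "\<And>s. \<bar>s - t\<bar> < \<epsilon> \<Longrightarrow> circle_point s \<in> U"
proof -
  have "open {s. circle_point s \<in> U}"
    using quotient_map_circle assms(1) openin_subset[OF assms(1)]
    unfolding quotient_map_def circle_point_def by simp
  then obtain \<epsilon> where "\<epsilon> > 0" "ball t \<epsilon> \<subseteq> {s. circle_point s \<in> U}"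
    using assms(2) by (auto simp: open_contains_ball)
  then show thesis by (intro that[of \<epsilon>]) (auto simp: dist_real_def abs_minus_commute subset_iff)
qed

text \<open>A basic open set restricts finitely many coordinates. Half of the radius pays for moving
  its real centres to rationals, the other half for the approximation; rational targets keep the
  number of finite tables small.\<close>

lemma dense_in_torus:
  assumes D: "D \<subseteq> carrier (torus_group I)"
    and approx: "\<And>J q \<epsilon>. finite J \<Longrightarrow> J \<subseteq> I \<Longrightarrow> \<epsilon> > 0 \<Longrightarrow>
      \<exists>p\<in>D. \<forall>i\<in>J. \<exists>t. \<bar>t - of_rat (q i)\<bar> < \<epsilon> \<and> p i = circle_point t"
  shows "dense_in (torus_topology I) D"
  unfolding dense_in_def
proof
  show "D \<subseteq> topspace (torus_topology I)" using D by (simp add: topspace_torus_topology)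
  have "D \<inter> W \<noteq> {}" if W: "openin (torus_topology I) W" "W \<noteq> {}" for W
  proof -
    obtain p where p: "p \<in> W" using W(2) by auto
    have "\<exists>U. finite {i \<in> I. U i \<noteq> topspace circle_topology} \<and>
      (\<forall>i\<in>I. openin circle_topology (U i)) \<and> p \<in> Pi\<^sub>E I U \<and> Pi\<^sub>E I U \<subseteq> W"
      using W(1) p unfolding torus_topology_def by (simp add: openin_product_topology_alt)
    then obtain U where U: "finite {i \<in> I. U i \<noteq> topspace circle_topology}"
      "\<forall>i\<in>I. openin circle_topology (U i)" "p \<in> Pi\<^sub>E I U" "Pi\<^sub>E I U \<subseteq> W"
      by (elim exE conjE)
    define J where "J = {i \<in> I. U i \<noteq> topspace circle_topology}"
    have "\<exists>t \<epsilon>. \<epsilon> > 0 \<and> (\<forall>s. \<bar>s - t\<bar> < \<epsilon> \<longrightarrow> circle_point s \<in> U i)" if i: "i \<in> J" for i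
    proof -
      have Ui: "openin circle_topology (U i)" "p i \<in> U i" using i U by (auto simp: J_def PiE_iff)
      then have "p i \<in> carrier circle_group"
        using openin_subset topspace_circle_topology by blast
      then obtain t where "p i = circle_point t" by (rule circle_pointE)
      then show ?thesis using openin_circle_point[OF Ui(1), of t] Ui(2) by metis
    qed
    then obtain t \<epsilon> where t: "\<And>i. i \<in> J \<Longrightarrow> \<epsilon> i > 0"
      "\<And>i s. i \<in> J \<Longrightarrow> \<bar>s - t i\<bar> < \<epsilon> i \<Longrightarrow> circle_point s \<in> U i"
      by metis
    \<comment> \<open>The extra \<open>1\<close> keeps the minimum meaningful when \<open>J\<close>
      is empty.\<close>
    define \<delta> where "\<delta> = Min (insert 1 (\<epsilon> ` J))"
    have J: "finite J" "J \<subseteq> I" using U(1) by (auto simp: J_def)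
    have \<delta>: "\<delta> > 0" using J(1) t(1) by (auto simp: \<delta>_def)
    have \<delta>_le: "\<delta> \<le> \<epsilon> i" if "i \<in> J" for i
      unfolding \<delta>_def using J(1) that by (intro Min_le) auto
    have "\<exists>q. \<bar>of_rat q - t i\<bar> < \<delta> / 2" for i
    proof -
      obtain q where "t i - \<delta> / 2 < of_rat q" "of_rat q < t i + \<delta> / 2"
        using of_rat_dense[of "t i - \<delta> / 2" "t i + \<delta> / 2"] \<delta> by auto
      then show ?thesis by (intro exI[of _ q]) linarith
    qed
    then obtain q where q: "\<And>i. \<bar>of_rat (q i) - t i\<bar> < \<delta> / 2" by metis
    obtain d where d: "d \<in> D" "\<forall>i\<in>J. \<exists>s. \<bar>s - of_rat (q i)\<bar> < \<delta> / 2 \<and> d i = circle_point s"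
      using approx[OF J, of "\<delta> / 2" q] \<delta> by auto
    have dI: "d \<in> (\<Pi>\<^sub>E i\<in>I. carrier circle_group)"
      using d(1) D by (auto simp: torus_group_def)
    have "d i \<in> U i" if "i \<in> I" for i
    proof (cases "i \<in> J")
      case True
      then obtain s where s: "\<bar>s - of_rat (q i)\<bar> < \<delta> / 2" "d i = circle_point s"
        using d(2) by auto
      have "\<bar>s - t i\<bar> < \<epsilon> i" using s(1) q[of i] \<delta>_le[OF True] by linarith
      then show ?thesis using t(2)[OF True] s(2) by simp
    next
      case False
      then show ?thesis using that dI by (auto simp: J_def topspace_circle_topology)
    qed
    then have "d \<in> Pi\<^sub>E I U" using dI by (auto simp: PiE_iff)
    then show ?thesis using d(1) U(4) by auto
  qed
  then show "torus_topology I closure_of D = topspace (torus_topology I)"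
    by (auto simp: dense_intersects_open)
qed

section \<open>Dense images of wide sets\<close>

lemma card_of_countable_ordLeq:
  assumes "infinite A"
  shows "|UNIV :: 'c::countable set| \<le>o |A|"
proof -
  have "|UNIV :: 'c set| \<le>o |UNIV :: nat set|"
    using card_of_ordLeq[of "UNIV :: 'c set" "UNIV :: nat set"] inj_to_nat by auto
  also have "|UNIV :: nat set| \<le>o |A|"
    using assms by (simp add: infinite_iff_card_of_nat)
  finally show ?thesis .
qed

lemma card_of_Times_infinite_ordLeq:
  assumes "infinite A" "|B| \<le>o |A|" "|C| \<le>o |A|"
  shows "|B \<times> C| \<le>o |A|"
  using assms by (intro card_of_Sigma_ordLeq_infinite) auto

lemma card_of_lists_infinite:
  assumes A: "infinite A"
  shows "|lists A| \<le>o |A|"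
proof -
  have len: "|{xs \<in> lists A. length xs = n}| \<le>o |A|" for n
  proof (induction n)
    case 0
    have "{xs \<in> lists A. length xs = 0} = {[]}" by auto
    moreover have "A \<noteq> {}" using A by auto
    ultimately show ?case by (simp add: card_of_singl_ordLeq)
  next
    case (Suc n)
    have "{xs \<in> lists A. length xs = Suc n} =
        (\<lambda>(a, xs). a # xs) ` (A \<times> {xs \<in> lists A. length xs = n})"
      by (auto simp: length_Suc_conv image_iff)
    also have "|\<dots>| \<le>o |A \<times> {xs \<in> lists A. length xs = n}|"
      by (rule card_of_image)
    also have "|A \<times> {xs \<in> lists A. length xs = n}| \<le>o |A|"
      using A card_of_refl[THEN ordIso_imp_ordLeq] Suc by (rule card_of_Times_infinite_ordLeq)
    finally show ?case .
  qed
  have "lists A = (\<Union>n. {xs \<in> lists A. length xs = n})" by auto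
  also have "|\<Union>n. {xs \<in> lists A. length xs = n}| \<le>o |A|"
    using A len by (intro card_of_UNION_ordLeq_infinite card_of_countable_ordLeq) auto
  finally show ?thesis .
qed

lemma card_of_codes:
  assumes "infinite A"
  shows "|lists A \<times> (UNIV :: 'c::countable set)| \<le>o |A|"
  using assms by (intro card_of_Times_infinite_ordLeq card_of_lists_infinite card_of_countable_ordLeq)

text \<open>\<open>Field \<tau>\<close> is mapped onto \<open>C \<times> Field \<tau>\<close>, so
  each element of \<open>C\<close> is hit by as many indices as \<open>Field \<tau>\<close> has; a
  proper initial segment of a cardinal is too small to contain them all.\<close>

lemma unbounded_enumeration:
  assumes \<tau>: "Cinfinite \<tau>" and C: "|C| \<le>o |Field \<tau>|" "C \<noteq> {}"
  obtains e where "\<And>c a. c \<in> C \<Longrightarrow> a \<in> Field \<tau> \<Longrightarrow> \<exists>b\<in>Field \<tau>. e b = c \<and> b \<notin> underS \<tau> a"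
proof -
  have inf: "infinite (Field \<tau>)" using \<tau> by (simp add: cinfinite_def)
  have "|C \<times> Field \<tau>| \<le>o |Field \<tau>|"
    using inf C(1) card_of_refl[THEN ordIso_imp_ordLeq] by (rule card_of_Times_infinite_ordLeq)
  moreover have "C \<times> Field \<tau> \<noteq> {}" using inf C(2) by auto
  ultimately obtain g where g: "g ` Field \<tau> = C \<times> Field \<tau>"
    using card_of_ordLeq2[of "C \<times> Field \<tau>" "Field \<tau>"] by auto
  show thesis
  proof (rule that[of "fst \<circ> g"])
    fix c a assume c: "c \<in> C" and a: "a \<in> Field \<tau>"
    show "\<exists>b\<in>Field \<tau>. (fst \<circ> g) b = c \<and> b \<notin> underS \<tau> a"
    proof (rule ccontr)
      assume neg: "\<not> ?thesis"
      have "{c} \<times> Field \<tau> \<subseteq> g ` underS \<tau> a"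
      proof
        fix p assume p: "p \<in> {c} \<times> Field \<tau>"
        then have "p \<in> g ` Field \<tau>" using g c by auto
        then obtain b where "b \<in> Field \<tau>" "g b = p" by auto
        then show "p \<in> g ` underS \<tau> a" using neg p by force
      qed
      then have "|{c} \<times> Field \<tau>| \<le>o |g ` underS \<tau> a|" by (rule card_of_mono1)
      also have "|g ` underS \<tau> a| \<le>o |underS \<tau> a|" by (rule card_of_image)
      finally have "|{c} \<times> Field \<tau>| \<le>o |underS \<tau> a|" .
      moreover have "|Field \<tau>| \<le>o |{c} \<times> Field \<tau>|" by (rule card_of_Times2) simp
      ultimately have "|Field \<tau>| \<le>o |underS \<tau> a|" using ordLeq_transitive by blast
      moreover have "|underS \<tau> a| <o |Field \<tau>|"
      proof -
        have "|underS \<tau> a| <o \<tau>" using \<tau> a by (intro card_of_underS) auto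
        moreover have "\<tau> =o |Field \<tau>|"
          using \<tau> card_of_Field_ordIso ordIso_symmetric by blast
        ultimately show ?thesis by (rule ordLess_ordIso_trans)
      qed
      ultimately show False using not_ordLess_ordLeq by blast
    qed
  qed
qed

lemma Func_separating_list:
  assumes J: "finite J" "J \<subseteq> Func A UNIV"
  obtains as where "as \<in> lists A" "inj_on (\<lambda>f. map f as) J"
proof -
  have "\<exists>a\<in>A. f a \<noteq> g a" if "f \<in> J" "g \<in> J" "f \<noteq> g" for f g
    using that J(2) by (auto simp: Func_def fun_eq_iff subset_iff) metis
  then obtain d where d: "\<And>f g. f \<in> J \<Longrightarrow> g \<in> J \<Longrightarrow> f \<noteq> g \<Longrightarrow> d f g \<in> A \<and> f (d f g) \<noteq> g (d f g)"
    by metis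
  have "finite {d f g | f g. f \<in> J \<and> g \<in> J \<and> f \<noteq> g}"
    by (rule finite_subset[of _ "(\<lambda>(f, g). d f g) ` (J \<times> J)"]) (use J(1) in auto)
  then obtain as where as: "set as = {d f g | f g. f \<in> J \<and> g \<in> J \<and> f \<noteq> g}"
    by (rule finite_list[THEN exE])
  show thesis
  proof
    show "as \<in> lists A" using as d by (auto simp: lists_eq_set)
    show "inj_on (\<lambda>f. map f as) J"
    proof (rule inj_onI, rule ccontr)
      fix f g assume fg: "f \<in> J" "g \<in> J" "map f as = map g as" "f \<noteq> g"
      then have "d f g \<in> set as" using as by auto
      then show False using fg d[of f g] by auto
    qed
  qed
qed

text \<open>A step function on \<open>2^\<tau>\<close> given by finite data: read the coordinates
  \<open>as\<close> and look the pattern up in the table \<open>ps\<close>, with \<open>0\<close>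
  for missing patterns. Being finite data, these functions number no more than
  \<open>Field \<tau>\<close>, although their domain is larger.\<close>

definition locally_constant :: "'k list \<Rightarrow> (bool list \<times> rat) list \<Rightarrow> ('k \<Rightarrow> bool) \<Rightarrow> rat" where
  "locally_constant as ps f = (case map_of ps (map f as) of Some q \<Rightarrow> q | None \<Rightarrow> 0)"

text \<open>The combinatorial core of the Hewitt-Marczewski-Pondiczery theorem: a window
  \<open>as\<close> separating the finite set \<open>J\<close> gives its points distinct patterns,
  so a table may assign them arbitrary rationals.\<close>

lemma locally_constant_interpolation:
  assumes J: "finite J" "J \<subseteq> Func A UNIV"
  obtains as ps where "as \<in> lists A" "\<And>f. f \<in> J \<Longrightarrow> locally_constant as ps f = q f"
proof -
  obtain as where as: "as \<in> lists A" "inj_on (\<lambda>f. map f as) J"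
    using J by (rule Func_separating_list)
  obtain fs where fs: "set fs = J" "distinct fs" using finite_distinct_list[OF J(1)] by auto
  let ?ps = "map (\<lambda>f. (map f as, q f)) fs"
  have "distinct (map fst ?ps)"
    using fs as(2) by (simp add: comp_def distinct_map)
  then have "map_of ?ps (map f as) = Some (q f)" if "f \<in> J" for f
    using that fs(1) by (intro map_of_is_SomeI) auto
  then show thesis using as(1) by (intro that[of as ?ps]) (auto simp: locally_constant_def)
qed

section \<open>Sequences in a wide set and characters with dense image\<close>

text \<open>Initial segments of a cardinal order are smaller than \<open>\<tau>\<close>, so wideness
  applies to the points chosen before stage \<open>a\<close>, with exponent
  \<open>fact (m a)\<close>.\<close>

lemma (in comm_group) wide_sequence:
  assumes \<tau>: "Card_order \<tau>" and S: "wide G \<tau> S"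
  obtains x where "\<And>a. a \<in> Field \<tau> \<Longrightarrow> x a \<in> S"
    "\<And>a. a \<in> Field \<tau> \<Longrightarrow> x a [^] (fact (m a) :: nat) \<notin> generate G (x ` underS \<tau> a)"
proof -
  have wo: "Well_order \<tau>" using \<tau> by (rule card_order_on_well_order_on)
  define Q where "Q f a s \<longleftrightarrow> (a \<in> Field \<tau> \<longrightarrow>
    s \<in> S \<and> s [^] (fact (m a) :: nat) \<notin> generate G (f ` underS \<tau> a))" for f a s
  have "\<exists>f. \<forall>a. Q f a (f a)"
  proof (rule dependent_wf_choice)
    show "wf (\<tau> - Id)" using wo by (simp add: well_order_on_def)
    show "Q f a s = Q g a s" if "\<And>b. (b, a) \<in> \<tau> - Id \<Longrightarrow> f b = g b" for f g a s
    proof -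
      have "f ` underS \<tau> a = g ` underS \<tau> a"
        using that by (intro image_cong) (auto simp: underS_def)
      then show ?thesis by (simp add: Q_def)
    qed
    show "\<exists>s. Q f a s" if Qb: "\<And>b. (b, a) \<in> \<tau> - Id \<Longrightarrow> Q f b (f b)" for a f
    proof (cases "a \<in> Field \<tau>")
      case False
      then show ?thesis by (auto simp: Q_def)
    next
      case True
      have "f ` underS \<tau> a \<subseteq> S"
      proof
        fix s assume "s \<in> f ` underS \<tau> a"
        then obtain b where b: "b \<in> underS \<tau> a" "s = f b" by auto
        then have "(b, a) \<in> \<tau> - Id" "b \<in> Field \<tau>" by (auto simp: underS_def Field_def)
        then show "s \<in> S" using Qb[of b] b(2) by (simp add: Q_def)
      qed
      moreover have "|f ` underS \<tau> a| <o \<tau>"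
        using card_of_image card_of_underS[OF \<tau> True] ordLeq_ordLess_trans by blast
      moreover have "(fact (m a) :: nat) \<ge> 1" by (rule fact_ge_1)
      ultimately have "(\<lambda>s. s [^] (fact (m a) :: nat)) ` S - generate G (f ` underS \<tau> a) \<noteq> {}"
        using S unfolding wide_def by blast
      then show ?thesis by (auto simp: Q_def)
    qed
  qed
  then obtain x where x: "\<And>a. Q x a (x a)" by blast
  show thesis by (rule that[of x]) (use x in \<open>auto simp: Q_def\<close>)
qed

text \<open>\<open>x\<close> precedes \<open>c\<close> and \<open>\<phi>\<close> because the
  embedding reads cutoffs and prescribed characters off the subgroup generated by \<open>x\<close>.
  Density is claimed for every \<open>\<rho>\<close> agreeing with \<open>\<psi>\<close> at the
  points \<open>x b\<close>, so characters may later be altered away from that subgroup.\<close>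

lemma (in comm_group) wide_dense_characters:
  fixes \<tau> :: "'k rel" and S :: "'a set"
  defines "I \<equiv> two_pow \<tau>"
  assumes \<tau>: "Cinfinite \<tau>" and S: "wide G \<tau> S"
  obtains x where "x ` Field \<tau> \<subseteq> carrier G"
    "\<forall>c \<in> I \<rightarrow> Field \<tau>. \<forall>\<phi> \<in> I \<rightarrow> hom G circle_group. \<exists>\<psi> \<in> I \<rightarrow> hom G circle_group.
      (\<forall>i\<in>I. \<forall>b\<in>underS \<tau> (c i). \<psi> i (x b) = \<phi> i (x b)) \<and>
      (\<forall>\<rho> \<in> I \<rightarrow> hom G circle_group. (\<forall>i\<in>I. \<forall>b\<in>Field \<tau>. \<rho> i (x b) = \<psi> i (x b)) \<longrightarrow>
        dense_in (torus_topology I) ((\<lambda>g. \<lambda>i\<in>I. \<rho> i g) ` S))"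
proof -
  interpret divisible_target G circle_group
    by (rule divisible_target_circle) (rule comm_group_axioms)
  have card: "Card_order \<tau>" and wo: "Well_order \<tau>" and inf: "infinite (Field \<tau>)"
    using \<tau> card_order_on_well_order_on[of "Field \<tau>" \<tau>] by (simp_all add: cinfinite_def)
  have SG: "S \<subseteq> carrier G" using S by (simp add: wide_def)
  define C :: "('k list \<times> (bool list \<times> rat) list \<times> nat) set"
    where "C = lists (Field \<tau>) \<times> UNIV"
  have "|C| \<le>o |Field \<tau>|" "C \<noteq> {}" unfolding C_def using inf by (auto intro: card_of_codes)
  then obtain e where e: "\<And>p a. p \<in> C \<Longrightarrow> a \<in> Field \<tau> \<Longrightarrow> \<exists>b\<in>Field \<tau>. e b = p \<and> b \<notin> underS \<tau> a"
    using unbounded_enumeration[OF \<tau>] by metis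
  \<comment> \<open>The successor keeps the precision \<open>1 / m a\<close> defined and matches the
    Archimedean bound \<open>inverse (Suc n)\<close> used for density.\<close>
  define m where "m a = Suc (snd (snd (e a)))" for a
  define d where "d a i = real_of_rat (locally_constant (fst (e a)) (fst (snd (e a))) i)" for a i
  obtain x where x: "\<And>a. a \<in> Field \<tau> \<Longrightarrow> x a \<in> S"
    "\<And>a. a \<in> Field \<tau> \<Longrightarrow> x a [^] (fact (m a) :: nat) \<notin> generate G (x ` underS \<tau> a)"
    using wide_sequence[OF card S, of m] by blast
  have xG: "x a \<in> carrier G" if "a \<in> Field \<tau>" for a using x(1)[OF that] SG by auto
  show thesis
  proof (rule that[of x], goal_cases)
    case 1
    show ?case using xG by auto
  next
    case 2
    show ?case
    proof (intro ballI)
      fix c and \<phi> :: "_ \<Rightarrow> 'a \<Rightarrow> real set"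
      assume "c \<in> I \<rightarrow> Field \<tau>" "\<phi> \<in> I \<rightarrow> hom G circle_group"
      then have c: "\<And>i. i \<in> I \<Longrightarrow> c i \<in> Field \<tau>" and \<phi>: "\<And>i. i \<in> I \<Longrightarrow> \<phi> i \<in> hom G circle_group"
        by auto
      \<comment> \<open>Below the cutoff \<open>c i\<close> the value is dictated by
        \<open>\<phi> i\<close>; from there on it approximates the target of stage
        \<open>a\<close>.\<close>
      define P where "P i a v \<longleftrightarrow> (if a \<in> underS \<tau> (c i) then v = \<phi> i (x a)
        else \<exists>\<epsilon>. \<bar>\<epsilon>\<bar> \<le> 1 / real (m a) \<and> v = circle_point (d a i + \<epsilon>))" for i a v
      have "\<exists>\<psi>\<in>hom G circle_group. \<forall>a\<in>Field \<tau>. P i a (\<psi> (x a))" if i: "i \<in> I" for i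
      proof -
        have step: "\<exists>\<psi>\<in>hom G circle_group. (\<forall>b\<in>underS \<tau> a. \<psi> (x b) = \<rho> (x b)) \<and> P i a (\<psi> (x a))"
          if a: "a \<in> Field \<tau>" and \<rho>: "\<rho> \<in> hom G circle_group"
            and P: "\<And>b. b \<in> underS \<tau> a \<Longrightarrow> P i b (\<rho> (x b))" for a \<rho>
        proof (cases "a \<in> underS \<tau> (c i)")
          case True
          \<comment> \<open>Everything before \<open>a\<close> is below the cutoff too, so
            \<open>P\<close> forces \<open>\<rho>\<close> to agree with \<open>\<phi> i\<close>
            there and \<open>\<phi> i\<close> itself continues it.\<close>
          have "b \<in> underS \<tau> (c i)" if "b \<in> underS \<tau> a" for b
            using True that wo
            unfolding underS_def well_order_on_def linear_order_on_def partial_order_on_def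
              preorder_on_def trans_def antisym_def by blast
          then show ?thesis using P True \<phi>[OF i] by (intro bexI[of _ "\<phi> i"]) (auto simp: P_def)
        next
          case False
          have sub: "x ` underS \<tau> a \<subseteq> carrier G"
            using xG by (auto simp: underS_def Field_def)
          have "m a > 0" by (simp add: m_def)
          then obtain \<psi> \<epsilon> where "\<psi> \<in> hom G circle_group"
            "\<And>g. g \<in> generate G (x ` underS \<tau> a) \<Longrightarrow> \<psi> g = \<rho> g"
            "\<bar>\<epsilon>\<bar> \<le> 1 / real (m a)" "\<psi> (x a) = circle_point (d a i + \<epsilon>)"
            using hom_circle_approximating[OF generate_is_subgroup[OF sub] xG[OF a] _ x(2)[OF a] \<rho>]
            by metis
          then show ?thesis using False by (intro bexI[of _ \<psi>]) (auto simp: P_def intro: generate.incl)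
        qed
        obtain \<psi> where "\<psi> \<in> hom G circle_group" "\<And>a. a \<in> Field \<tau> \<Longrightarrow> P i a (\<psi> (x a))"
          using hom_transfinite_recursion[OF wo xG step] by blast
        then show ?thesis by blast
      qed
      then obtain \<psi> where \<psi>: "\<And>i. i \<in> I \<Longrightarrow> \<psi> i \<in> hom G circle_group"
        "\<And>i a. i \<in> I \<Longrightarrow> a \<in> Field \<tau> \<Longrightarrow> P i a (\<psi> i (x a))" by metis
      have dense: "dense_in (torus_topology I) ((\<lambda>g. \<lambda>i\<in>I. \<rho> i g) ` S)"
        if \<rho>: "\<And>i. i \<in> I \<Longrightarrow> \<rho> i \<in> hom G circle_group"
          "\<And>i b. i \<in> I \<Longrightarrow> b \<in> Field \<tau> \<Longrightarrow> \<rho> i (x b) = \<psi> i (x b)" for \<rho>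
      proof (rule dense_in_torus)
        show "(\<lambda>g. \<lambda>i\<in>I. \<rho> i g) ` S \<subseteq> carrier (torus_group I)"
          using hom_in_carrier[OF hom_torus[of I \<rho>, OF \<rho>(1)]] SG by blast
        fix J q and \<delta> :: real assume J: "finite J" "J \<subseteq> I" and \<delta>: "\<delta> > 0"
        obtain as ps where as: "as \<in> lists (Field \<tau>)"
          "\<And>i. i \<in> J \<Longrightarrow> locally_constant as ps i = q i"
          using J locally_constant_interpolation[of J "Field \<tau>" q]
          by (auto simp: I_def Field_ctwo_cexp)
        obtain n where n: "inverse (real (Suc n)) < \<delta>" using reals_Archimedean[OF \<delta>] by blast
        \<comment> \<open>\<open>b0\<close> dominates the cutoffs of the finitely many coordinates
          in \<open>J\<close>. The required code recurs at some \<open>b\<close> not below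
          \<open>b0\<close>, where every coordinate in \<open>J\<close> is in its approximating
          phase.\<close>
        obtain b0 where b0: "b0 \<in> Field \<tau>" "\<And>i. i \<in> J \<Longrightarrow> (c i, b0) \<in> \<tau>"
        proof (cases "J = {}")
          case True
          then show thesis using inf that by (metis empty_iff ex_in_conv finite.emptyI)
        next
          case False
          then obtain b0 where "b0 \<in> c ` J" "\<And>a. a \<in> c ` J \<Longrightarrow> (a, b0) \<in> \<tau>"
            using Well_order_finite_max[OF wo, of "c ` J"] J c by (metis (no_types, lifting)
                finite_imageI image_is_empty image_subset_iff subsetD)
          then show thesis using c J(2) by (intro that[of b0]) auto
        qed
        have "(as, ps, n) \<in> C" using as by (simp add: C_def)
        then obtain b where b: "b \<in> Field \<tau>" "e b = (as, ps, n)" "b \<notin> underS \<tau> b0"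
          using e b0(1) by blast
        show "\<exists>p\<in>(\<lambda>g. \<lambda>i\<in>I. \<rho> i g) ` S. \<forall>i\<in>J. \<exists>t. \<bar>t - of_rat (q i)\<bar> < \<delta> \<and> p i = circle_point t"
        proof (rule bexI[of _ "\<lambda>i\<in>I. \<rho> i (x b)"], rule ballI)
          show "(\<lambda>i\<in>I. \<rho> i (x b)) \<in> (\<lambda>g. \<lambda>i\<in>I. \<rho> i g) ` S" using x(1)[OF b(1)] by auto
          fix i assume i: "i \<in> J"
          have iI: "i \<in> I" using i J(2) by auto
          have "b \<notin> underS \<tau> (c i)"
            using b(3) b0(2)[OF i] wo
            unfolding underS_def well_order_on_def linear_order_on_def partial_order_on_def
              preorder_on_def trans_def antisym_def by blast
          then obtain \<epsilon> where \<epsilon>: "\<bar>\<epsilon>\<bar> \<le> 1 / real (m b)" "\<psi> i (x b) = circle_point (d b i + \<epsilon>)"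
            using \<psi>(2)[OF iI b(1)] by (auto simp: P_def)
          have "\<bar>\<epsilon>\<bar> < \<delta>" using \<epsilon>(1) n b(2) by (simp add: m_def inverse_eq_divide)
          moreover have "d b i = of_rat (q i)" using b(2) as(2)[OF i] by (simp add: d_def)
          ultimately show "\<exists>t. \<bar>t - of_rat (q i)\<bar> < \<delta> \<and> (\<lambda>i\<in>I. \<rho> i (x b)) i = circle_point t"
            using iI \<rho>(2)[OF iI b(1)] \<epsilon>(2) by (intro exI[of _ "d b i + \<epsilon>"]) auto
        qed
      qed
      have "\<psi> i (x b) = \<phi> i (x b)" if "i \<in> I" "b \<in> underS \<tau> (c i)" for i b
      proof -
        have "b \<in> Field \<tau>" using that(2) by (auto simp: underS_def Field_def)
        then show ?thesis using \<psi>(2)[OF that(1), of b] that(2) by (simp add: P_def)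
      qed
      then show "\<exists>\<psi> \<in> I \<rightarrow> hom G circle_group.
          (\<forall>i\<in>I. \<forall>b\<in>underS \<tau> (c i). \<psi> i (x b) = \<phi> i (x b)) \<and>
          (\<forall>\<rho> \<in> I \<rightarrow> hom G circle_group. (\<forall>i\<in>I. \<forall>b\<in>Field \<tau>. \<rho> i (x b) = \<psi> i (x b)) \<longrightarrow>
            dense_in (torus_topology I) ((\<lambda>g. \<lambda>i\<in>I. \<rho> i g) ` S))"
        using \<psi>(1) dense by (intro bexI[of _ \<psi>]) (simp_all add: Pi_iff)
    qed
  qed
qed

section \<open>Separating characters\<close>

text \<open>Equivalently, the generated subgroup is the direct sum of the cyclic groups of the
  members of \<open>X\<close>; torsion elements are allowed.\<close>

definition (in group) independent :: "'a set \<Rightarrow> bool" where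
  "independent X \<longleftrightarrow> X \<subseteq> carrier G \<and>
     (\<forall>x\<in>X. \<forall>k::int. x [^] k \<in> generate G (X - {x}) \<longrightarrow> x [^] k = \<one>)"

text \<open>If \<open>x [^] k = z \<otimes> y [^] n\<close> with \<open>z\<close> generated by
  \<open>X - {x}\<close>, then \<open>y [^] n\<close> is generated by \<open>X\<close>, hence
  trivial, and the relation reduces to one inside \<open>X\<close>.\<close>

lemma (in comm_group) independent_insert:
  assumes X: "independent X" and y: "y \<in> carrier G"
    and yX: "\<And>k::int. y [^] k \<in> generate G X \<Longrightarrow> y [^] k = \<one>"
  shows "independent (insert y X)"
  unfolding independent_def
proof (intro conjI ballI allI impI)
  have XG: "X \<subseteq> carrier G" using X by (simp add: independent_def)
  then show "insert y X \<subseteq> carrier G" using y by simp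
  fix x and k :: int
  assume x: "x \<in> insert y X" and xk: "x [^] k \<in> generate G (insert y X - {x})"
  show "x [^] k = \<one>"
  proof (cases "x = y")
    case True
    have "generate G (insert y X - {x}) \<subseteq> generate G X"
      using XG True by (intro mono_generate) auto
    then show ?thesis using yX xk True by auto
  next
    case False
    then have xX: "x \<in> X" "x \<in> carrier G" using x XG by auto
    let ?K = "generate G (X - {x})"
    have K: "subgroup ?K G" using XG by (intro generate_is_subgroup) auto
    have "insert y X - {x} \<subseteq> insert y ?K" by (auto intro: generate.incl)
    then have "generate G (insert y X - {x}) \<subseteq> generate G (insert y ?K)"
      by (rule mono_generate)
    then obtain z and n :: int where z: "z \<in> ?K" "x [^] k = z \<otimes> y [^] n"
      using xk generate_insert_subset[OF K y] by blast
    have zG: "z \<in> carrier G" using K z(1) by (rule subgroup.mem_carrier)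
    have KX: "?K \<subseteq> generate G X" by (intro mono_generate) auto
    have SX: "subgroup (generate G X) G" using XG by (rule generate_is_subgroup)
    have "y [^] n = inv z \<otimes> x [^] k"
      using z(2) zG xX y by (simp add: m_assoc[symmetric])
    also have "\<dots> \<in> generate G X"
      using SX KX z(1) xX subgroup_int_pow_closed[OF SX generate.incl[OF xX(1)]]
      by (intro subgroup.m_closed subgroup.m_inv_closed) auto
    finally have "y [^] n = \<one>" by (rule yX)
    then have "x [^] k \<in> ?K" using z zG by simp
    then show ?thesis using X xX(1) by (auto simp: independent_def)
  qed
qed

text \<open>The second property makes the subgroup generated by \<open>X\<close> essential:
  homomorphisms jointly injective on it are jointly injective on \<open>G\<close>. A
  \<open>y\<close> violating it could be adjoined to \<open>X\<close>, so it would lie in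
  \<open>X\<close>, and \<open>k = 1\<close> contradicts the violation.\<close>

lemma (in comm_group) maximal_independent:
  obtains X where "independent X"
    "\<And>y. y \<in> carrier G \<Longrightarrow> y \<noteq> \<one> \<Longrightarrow> \<exists>k::int. y [^] k \<in> generate G X \<and> y [^] k \<noteq> \<one>"
proof -
  have "\<exists>X\<in>Collect independent. \<forall>Y\<in>Collect independent. X \<subseteq> Y \<longrightarrow> Y = X"
  proof (rule subset_Zorn_nonempty)
    have "independent {}" by (simp add: independent_def)
    then show "Collect independent \<noteq> {}" by blast
    fix \<C> assume ne: "\<C> \<noteq> {}" and chain: "subset.chain (Collect independent) \<C>"
    then have ind: "independent M" if "M \<in> \<C>" for M
      using that by (auto simp: subset_chain_def)
    have "x [^] k = \<one>"
      if x: "x \<in> \<Union>\<C>" and xk: "x [^] k \<in> generate G (\<Union>\<C> - {x})" for x and k :: int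
    proof -
      obtain F where F: "finite F" "F \<subseteq> \<Union>\<C> - {x}" "x [^] k \<in> generate G F"
        using xk by (rule generate_finite_subset)
      have "finite (insert x F)" "insert x F \<subseteq> \<Union>\<C>" using F x by auto
      then obtain M where M: "M \<in> \<C>" "insert x F \<subseteq> M"
        using finite_subset_Union_chain[OF _ _ ne chain] by metis
      have "x [^] k \<in> generate G (M - {x})"
        using mono_generate[of F "M - {x}"] F M by blast
      then show ?thesis using ind[OF M(1)] M(2) by (auto simp: independent_def)
    qed
    moreover have "\<Union>\<C> \<subseteq> carrier G" using ind by (auto simp: independent_def)
    ultimately show "\<Union>\<C> \<in> Collect independent" by (auto simp: independent_def)
  qed
  then obtain X where X: "independent X" and max: "\<And>Y. independent Y \<Longrightarrow> X \<subseteq> Y \<Longrightarrow> Y = X"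
    by (metis mem_Collect_eq)
  show thesis
  proof (rule that[OF X])
    fix y assume y: "y \<in> carrier G" "y \<noteq> \<one>"
    show "\<exists>k::int. y [^] k \<in> generate G X \<and> y [^] k \<noteq> \<one>"
    proof (rule ccontr)
      assume *: "\<not> ?thesis"
      then have "insert y X = X"
        using X y by (intro max independent_insert) auto
      then have "y [^] (1::int) \<in> generate G X" using y by (auto intro: generate.incl)
      then show False using * y by (metis int_pow_1)
    qed
  qed
qed

text \<open>Finds a generator with a nontrivial contribution, to be detected by a character killing
  the others. Generators are stripped one at a time: if the power of \<open>a\<close> is trivial,
  \<open>w\<close> is generated by the rest.\<close>

lemma (in comm_group) generate_finite_decompose:
  assumes "finite F" "F \<subseteq> carrier G" "w \<in> generate G F" "w \<noteq> \<one>"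
  shows "\<exists>x\<in>F. \<exists>z\<in>generate G (F - {x}). \<exists>k::int. w = z \<otimes> x [^] k \<and> x [^] k \<noteq> \<one>"
  using assms
proof (induction F)
  case empty
  then show ?case by (simp add: generate_empty)
next
  case (insert a F)
  have K: "subgroup (generate G F) G" using insert.prems by (intro generate_is_subgroup) auto
  have a: "a \<in> carrier G" using insert.prems by auto
  have "generate G (insert a F) \<subseteq> generate G (insert a (generate G F))"
    by (intro mono_generate) (auto intro: generate.incl)
  then obtain z and k :: int where z: "z \<in> generate G F" "w = z \<otimes> a [^] k"
    using insert.prems(2) generate_insert_subset[OF K a] by blast
  show ?case
  proof (cases "a [^] k = \<one>")
    case True
    then have "w = z" using z subgroup.mem_carrier[OF K] by auto
    then obtain x y and l :: int where x: "x \<in> F" "y \<in> generate G (F - {x})"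
      "w = y \<otimes> x [^] l" "x [^] l \<noteq> \<one>"
      using insert.IH insert.prems z by auto
    have "generate G (F - {x}) \<subseteq> generate G (insert a F - {x})"
      by (intro mono_generate) auto
    then show ?thesis using x by blast
  next
    case False
    have "insert a F - {a} = F" using insert.hyps by auto
    then have "z \<in> generate G (insert a F - {a})" using z(1) by simp
    then show ?thesis using z(2) False by blast
  qed
qed

context divisible_target
begin

lemma subgroup_common_kernel:
  assumes "\<Phi> \<subseteq> hom G D"
  shows "subgroup {g \<in> carrier G. \<forall>\<phi>\<in>\<Phi>. \<phi> g = \<one>\<^bsub>D\<^esub>} G" (is "subgroup ?K G")
proof -
  have gh: "group_hom G D \<phi>" if "\<phi> \<in> \<Phi>" for \<phi>
    using that assms by unfold_locales auto
  show ?thesis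
  proof (rule G.subgroupI)
    show "?K \<subseteq> carrier G" by blast
    have "\<one> \<in> ?K" using gh[THEN group_hom.hom_one] by simp
    then show "?K \<noteq> {}" by blast
  next
    fix a assume a: "a \<in> ?K"
    have "\<phi> (inv a) = \<one>\<^bsub>D\<^esub>" if \<phi>: "\<phi> \<in> \<Phi>" for \<phi>
    proof -
      have "a \<in> carrier G" "\<phi> a = \<one>\<^bsub>D\<^esub>" using a \<phi> by blast+
      then show ?thesis using group_hom.hom_inv[OF gh[OF \<phi>], of a] by simp
    qed
    then show "inv a \<in> ?K" using a G.inv_closed by blast
  next
    fix a b assume ab: "a \<in> ?K" "b \<in> ?K"
    have "\<phi> (a \<otimes> b) = \<one>\<^bsub>D\<^esub>" if \<phi>: "\<phi> \<in> \<Phi>" for \<phi>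
    proof -
      have "a \<in> carrier G" "\<phi> a = \<one>\<^bsub>D\<^esub>" "b \<in> carrier G" "\<phi> b = \<one>\<^bsub>D\<^esub>"
        using ab \<phi> by blast+
      then show ?thesis using group_hom.hom_mult[OF gh[OF \<phi>], of a b] by simp
    qed
    then show "a \<otimes> b \<in> ?K" using ab G.m_closed by blast
  qed
qed

lemma hom_eq_on_generate:
  assumes "\<phi> \<in> hom G D" "\<psi> \<in> hom G D" "A \<subseteq> carrier G"
    and eq: "\<And>a. a \<in> A \<Longrightarrow> \<phi> a = \<psi> a" and g: "g \<in> generate G A"
  shows "\<phi> g = \<psi> g"
proof -
  interpret \<phi>: group_hom G D \<phi> by unfold_locales fact
  interpret \<psi>: group_hom G D \<psi> by unfold_locales fact
  have AG: "a \<in> carrier G" if "a \<in> A" for a using that assms(3) by auto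
  from g have "g \<in> carrier G \<and> \<phi> g = \<psi> g"
  proof induction
    case one
    show ?case by simp
  next
    case (incl h)
    then show ?case by (simp add: AG eq)
  next
    case (inv h)
    then show ?case by (simp add: AG eq)
  next
    case (eng h1 h2)
    then show ?case by simp
  qed
  then show ?thesis ..
qed

text \<open>Compactness reduces to finite sets, where one generator is added at a time: by
  independence its powers in the span of the others are trivial, so the orders in \<open>tk\<close>
  are the only obstruction.\<close>

lemma hom_on_independent:
  assumes X: "G.independent X" and t: "\<And>x. x \<in> X \<Longrightarrow> t x \<in> carrier D"
    and tk: "\<And>x k. x \<in> X \<Longrightarrow> x [^] (k::int) = \<one> \<Longrightarrow> t x [^]\<^bsub>D\<^esub> k = \<one>\<^bsub>D\<^esub>"
  obtains \<phi> where "\<phi> \<in> hom G D" "\<And>x. x \<in> X \<Longrightarrow> \<phi> x = t x"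
proof -
  have XG: "X \<subseteq> carrier G" using X by (simp add: G.independent_def)
  have fin: "\<exists>\<phi>\<in>hom G D. \<forall>x\<in>E. \<phi> x = t x" if "finite E" "E \<subseteq> X" for E
    using that
  proof (induction E)
    case empty
    then show ?case using trivial_hom by blast
  next
    case (insert x E)
    then obtain \<phi> where \<phi>: "\<phi> \<in> hom G D" "\<forall>x\<in>E. \<phi> x = t x" by auto
    have x: "x \<in> X" "x \<in> carrier G" using insert.prems XG by auto
    have \<phi>x: "\<phi> x \<in> carrier D" using \<phi>(1) x(2) by (rule hom_in_carrier)
    \<comment> \<open>The factor by which \<open>\<phi>\<close> misses the target at
      \<open>x\<close>; \<open>\<rho>\<close> supplies it without disturbing the values on
      \<open>E\<close>.\<close>
    define s where "s = t x \<otimes>\<^bsub>D\<^esub> inv\<^bsub>D\<^esub> \<phi> x"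
    have s: "s \<in> carrier D" using \<phi>x t[OF x(1)] by (simp add: s_def)
    have K: "subgroup (generate G E) G" using insert.prems XG by (intro G.generate_is_subgroup) auto
    have ks: "s [^]\<^bsub>D\<^esub> k = \<one>\<^bsub>D\<^esub>" if "x [^] k \<in> generate G E" for k :: int
    proof -
      have "generate G E \<subseteq> generate G (X - {x})"
        using insert.prems insert.hyps by (intro G.mono_generate) auto
      then have xk: "x [^] k = \<one>" using that X x(1) by (auto simp: G.independent_def)
      then have "\<phi> x [^]\<^bsub>D\<^esub> k = \<one>\<^bsub>D\<^esub>"
        using hom_power[OF \<phi>(1) x(2), of k] hom_one[OF \<phi>(1)] by simp
      then show ?thesis using tk[OF x(1) xk] t[OF x(1)] \<phi>x
        by (simp add: s_def D.int_pow_distrib D.int_pow_inv)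
    qed
    obtain \<rho> where \<rho>: "\<rho> \<in> hom G D" "\<And>g. g \<in> generate G E \<Longrightarrow> \<rho> g = \<one>\<^bsub>D\<^esub>" "\<rho> x = s"
      using hom_trivial_on_subgroup[OF K x(2) s ks] by blast
    have "\<phi> y \<otimes>\<^bsub>D\<^esub> \<rho> y = t y" if "y \<in> insert x E" for y
    proof (cases "y = x")
      case True
      have "\<phi> x \<otimes>\<^bsub>D\<^esub> s = t x"
        using D.m_comm[OF \<phi>x s] \<phi>x t[OF x(1)] by (simp add: s_def D.m_assoc)
      then show ?thesis using True \<rho>(3) by simp
    next
      case False
      then have "y \<in> E" using that by auto
      then show ?thesis using \<phi>(2) \<rho>(2)[OF generate.incl] t[of y] insert.prems by auto
    qed
    then show ?case using hom_mult[OF \<phi>(1) \<rho>(1)] by (intro bexI) auto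
  qed
  have "\<exists>\<phi>\<in>hom G D. \<forall>(g, s)\<in>F. \<phi> g = s"
    if F: "finite F" "F \<subseteq> (\<lambda>x. (x, t x)) ` X" for F
  proof -
    obtain E where "finite E" "E \<subseteq> X" "F = (\<lambda>x. (x, t x)) ` E"
      using finite_subset_image[OF F] by auto
    then show ?thesis using fin by force
  qed
  moreover have "(\<lambda>x. (x, t x)) ` X \<subseteq> carrier G \<times> carrier D" using XG t by auto
  ultimately obtain \<phi> where "\<phi> \<in> hom G D" "\<And>g s. (g, s) \<in> (\<lambda>x. (x, t x)) ` X \<Longrightarrow> \<phi> g = s"
    by (rule_tac hom_if_finite_subgraphs[of "(\<lambda>x. (x, t x)) ` X"]) auto
  then show thesis by (intro that[of \<phi>]) auto
qed

end

text \<open>It suffices to detect the nontrivial elements of the essential subgroup generated by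
  \<open>X\<close>. The injection \<open>f\<close> labels points by functions on \<open>I\<close>,
  and a character is described by finitely many coordinates, a pattern on them and an order, which
  gives at most \<open>|I|\<close> descriptions.\<close>

lemma (in comm_group) few_separating_characters:
  fixes I :: "'i set"
  assumes I: "infinite I" and card: "|carrier G| \<le>o |Func I (UNIV :: bool set)|"
  obtains E where "E \<subseteq> hom G circle_group" "E \<noteq> {}" "|E| \<le>o |I|"
    "\<forall>y\<in>carrier G. (\<forall>\<phi>\<in>E. \<phi> y = \<one>\<^bsub>circle_group\<^esub>) \<longrightarrow> y = \<one>"
proof -
  interpret divisible_target G circle_group
    by (rule divisible_target_circle) (rule comm_group_axioms)
  obtain f where f: "inj_on f (carrier G)" "f ` carrier G \<subseteq> Func I (UNIV :: bool set)"
    using card unfolding card_of_ordLeq[symmetric] by (elim exE conjE)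
  obtain X where X: "independent X"
    "\<And>y. y \<in> carrier G \<Longrightarrow> y \<noteq> \<one> \<Longrightarrow> \<exists>k::int. y [^] k \<in> generate G X \<and> y [^] k \<noteq> \<one>"
    using maximal_independent by blast
  have XG: "X \<subseteq> carrier G" using X by (simp add: independent_def)
  have "\<exists>n::nat. \<forall>k::int. x [^] k = \<one> \<longleftrightarrow> int n dvd k" if "x \<in> carrier G" for x
    using power_exponents_in_subgroup[OF triv_subgroup that] by (metis singleton_iff)
  then obtain N where N: "\<And>x k. x \<in> carrier G \<Longrightarrow> x [^] (k::int) = \<one> \<longleftrightarrow> int (N x) dvd k"
    by metis
  have "\<exists>t::real. \<forall>k::int. of_int k * t \<in> \<int> \<longleftrightarrow> int n dvd k" for n
    using real_of_order_mod_Ints by blast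
  then obtain t where t: "\<And>n k. real_of_int k * t n \<in> \<int> \<longleftrightarrow> int n dvd k" by metis
  \<comment> \<open>The code selects the points of order \<open>n\<close> whose label shows the
    pattern \<open>bs\<close> on \<open>as\<close>; these go to a circle point of order exactly
    \<open>n\<close>, all others to the identity.\<close>
  define v where "v = (\<lambda>(as, bs, n) x. if map (f x) as = bs \<and> N x = n
    then circle_point (t n) else \<one>\<^bsub>circle_group\<^esub>)"
  have "\<exists>\<phi>\<in>hom G circle_group. \<forall>x\<in>X. \<phi> x = v c x" for c
  proof -
    have "v c x [^]\<^bsub>circle_group\<^esub> k = \<one>\<^bsub>circle_group\<^esub>"
      if "x \<in> X" "x [^] k = \<one>" for x and k :: int
      using that N XG by (auto simp: v_def circle_point_eq_one_iff t split: prod.split)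
    moreover have "v c x \<in> carrier circle_group" for x
      by (auto simp: v_def split: prod.split)
    ultimately obtain \<phi> where "\<phi> \<in> hom G circle_group" "\<And>x. x \<in> X \<Longrightarrow> \<phi> x = v c x"
      by (rule_tac hom_on_independent[OF X(1), of "v c"]) auto
    then show ?thesis by (intro bexI[of _ \<phi>]) auto
  qed
  then obtain h where h: "\<And>c. h c \<in> hom G circle_group" "\<And>c x. x \<in> X \<Longrightarrow> h c x = v c x"
    by metis
  let ?C = "lists I \<times> (UNIV :: (bool list \<times> nat) set)"
  show thesis
  proof (rule that[of "h ` ?C"])
    show "h ` ?C \<subseteq> hom G circle_group" using h(1) by auto
    show "h ` ?C \<noteq> {}" by auto
    show "|h ` ?C| \<le>o |I|"
      using card_of_image card_of_codes[OF I] ordLeq_transitive by blast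
    show "\<forall>y\<in>carrier G. (\<forall>\<phi>\<in>h ` ?C. \<phi> y = \<one>\<^bsub>circle_group\<^esub>) \<longrightarrow> y = \<one>"
    proof (intro ballI impI, rule ccontr)
      fix y assume y: "y \<in> carrier G" and hy: "\<forall>\<phi>\<in>h ` ?C. \<phi> y = \<one>\<^bsub>circle_group\<^esub>"
      assume "y \<noteq> \<one>"
      then obtain k :: int where k: "y [^] k \<in> generate G X" "y [^] k \<noteq> \<one>"
        using X(2) y by blast
      obtain F where F: "finite F" "F \<subseteq> X" "y [^] k \<in> generate G F"
        using k(1) by (rule generate_finite_subset)
      have FG: "F \<subseteq> carrier G" using F XG by auto
      obtain x z and l :: int where x: "x \<in> F" and z: "z \<in> generate G (F - {x})"
        and yk: "y [^] k = z \<otimes> x [^] l" and xl: "x [^] l \<noteq> \<one>"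
        using generate_finite_decompose[OF F(1) FG F(3) k(2)] by blast
      have xG: "x \<in> carrier G" "x \<in> X" using x F XG by auto
      have fF: "finite (f ` F)" "f ` F \<subseteq> Func I UNIV" using F(1) FG f(2) by auto
      \<comment> \<open>On this window no other point of \<open>F\<close> shares the pattern of
        \<open>x\<close>, so the coded character kills \<open>F - {x}\<close>, hence
        \<open>z\<close>, while \<open>x [^] l\<close> survives because orders match.\<close>
      obtain as where as: "as \<in> lists I" "inj_on (\<lambda>g. map g as) (f ` F)"
        using Func_separating_list[OF fF] by blast
      define c where "c = (as, map (f x) as, N x)"
      have c: "c \<in> ?C" using as(1) by (simp add: c_def)
      have "h c a = \<one>\<^bsub>circle_group\<^esub>" if a: "a \<in> F - {x}" for a
      proof -
        have "f a \<noteq> f x" using a x FG f(1) by (auto simp: inj_on_def)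
        then have "map (f a) as \<noteq> map (f x) as"
          using a x inj_onD[OF as(2), of "f a" "f x"] by auto
        then have "v c a = \<one>\<^bsub>circle_group\<^esub>" by (simp only: v_def c_def split if_False simp_thms)
        moreover have "a \<in> X" using a F(2) by auto
        ultimately show ?thesis using h(2)[of a c] by simp
      qed
      then have hz: "h c z = \<one>\<^bsub>circle_group\<^esub>"
        by (rule hom_eq_on_generate[OF h(1) trivial_hom _ _ z, rotated]) (use FG in auto)
      have "h c x [^]\<^bsub>circle_group\<^esub> l = circle_point (of_int l * t (N x))"
        using h(2)[OF xG(2), of c] by (simp add: v_def c_def)
      then have "h c (x [^] l) \<noteq> \<one>\<^bsub>circle_group\<^esub>"
        using hom_power[OF h(1) xG(1), of c l] xl N[OF xG(1)] t by (simp add: circle_point_eq_one_iff)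
      moreover have "h c (y [^] k) = \<one>\<^bsub>circle_group\<^esub>"
      proof -
        have "h c y = \<one>\<^bsub>circle_group\<^esub>" using hy c by blast
        then show ?thesis using hom_power[OF h(1) y, of c k] by simp
      qed
      moreover have "h c (y [^] k) = h c z \<otimes>\<^bsub>circle_group\<^esub> h c (x [^] l)"
      proof -
        have "z \<in> carrier G" using z FG generate_in_carrier[of "F - {x}" z] by auto
        then show ?thesis unfolding yk using Group.hom_mult[OF h(1), of z "x [^] l" c] xG by simp
      qed
      ultimately show False
        using hz hom_in_carrier[OF h(1), of "x [^] l" c] xG by simp
    qed
  qed
qed

section \<open>From dense images to dense embeddings\<close>

lemma (in comm_group) card_of_generate_infinite:
  assumes A: "infinite A" and x: "x ` A \<subseteq> carrier G"
  shows "|generate G (x ` A)| \<le>o |A|"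
proof -
  \<comment> \<open>Evaluates words in the generators, \<open>True\<close> marking a generator and
    \<open>False\<close> its inverse; there are at most \<open>|A|\<close> words.\<close>
  define w where "w = foldr (\<lambda>(a, b) g. (if b then x a else inv x a) \<otimes> g)"
  have w_carrier: "w ps \<one> \<in> carrier G" if "ps \<in> lists (A \<times> UNIV)" for ps
    using that x by (induction ps) (auto simp: w_def)
  have w_append: "w ps \<one> \<otimes> w qs \<one> = w (ps @ qs) \<one>"
    if "ps \<in> lists (A \<times> UNIV)" "qs \<in> lists (A \<times> UNIV)" for ps qs
    using that(1)
  proof (induction ps)
    case Nil
    then show ?case using w_carrier[OF that(2)] by (simp add: w_def)
  next
    case (Cons p ps)
    obtain a b where p: "p = (a, b)" by (cases p)
    have "x a \<in> carrier G" using Cons x p by auto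
    moreover have "w (p # ps) \<one> = (if b then x a else inv x a) \<otimes> w ps \<one>"
      "w (p # ps @ qs) \<one> = (if b then x a else inv x a) \<otimes> w (ps @ qs) \<one>"
      using p by (simp_all add: w_def)
    ultimately show ?case
      using Cons w_carrier[OF that(2)] w_carrier[of ps] by (simp add: m_assoc)
  qed
  have "g \<in> (\<lambda>ps. w ps \<one>) ` lists (A \<times> UNIV)" if "g \<in> generate G (x ` A)" for g
    using that
  proof induction
    case one
    show ?case by (rule image_eqI[of _ _ "[]"]) (auto simp: w_def)
  next
    case (incl h)
    then obtain a where "a \<in> A" "h = x a" by auto
    then show ?case using x by (intro image_eqI[of _ _ "[(a, True)]"]) (auto simp: w_def)
  next
    case (inv h)
    then obtain a where "a \<in> A" "h = x a" by auto
    then show ?case using x by (intro image_eqI[of _ _ "[(a, False)]"]) (auto simp: w_def)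
  next
    case (eng g h)
    then obtain ps qs where "ps \<in> lists (A \<times> UNIV)" "qs \<in> lists (A \<times> UNIV)"
      "g = w ps \<one>" "h = w qs \<one>" by auto
    then show ?case using w_append by (intro image_eqI[of _ _ "ps @ qs"]) auto
  qed
  then have "|generate G (x ` A)| \<le>o |(\<lambda>ps. w ps \<one>) ` lists (A \<times> (UNIV :: bool set))|"
    by (intro card_of_mono1) blast
  also have "|(\<lambda>ps. w ps \<one>) ` lists (A \<times> (UNIV :: bool set))| \<le>o |lists (A \<times> (UNIV :: bool set))|"
    by (rule card_of_image)
  also have "|lists (A \<times> (UNIV :: bool set))| \<le>o |A \<times> (UNIV :: bool set)|"
    using A by (intro card_of_lists_infinite) (auto dest: finite_cartesian_productD1)
  also have "|A \<times> (UNIV :: bool set)| \<le>o |A|"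
    by (rule card_of_Times_infinite_ordLeq[OF A card_of_refl[THEN ordIso_imp_ordLeq]
        card_of_countable_ordLeq[OF A]])
  finally show ?thesis .
qed

text \<open>Finitely many generators occur, and an infinite cardinal order has no largest element,
  so some index lies strictly above all of them.\<close>

lemma generate_image_underS:
  assumes \<tau>: "Cinfinite \<tau>" and g: "g \<in> generate G (x ` Field \<tau>)"
  obtains a where "a \<in> Field \<tau>" "g \<in> generate G (x ` underS \<tau> a)"
proof -
  have wo: "Well_order \<tau>" and inf: "infinite (Field \<tau>)" and card: "Card_order \<tau>"
    using \<tau> card_order_on_well_order_on[of "Field \<tau>" \<tau>] by (simp_all add: cinfinite_def)
  obtain F where F: "finite F" "F \<subseteq> x ` Field \<tau>" "g \<in> generate G F"
    using g by (rule generate_finite_subset)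
  obtain E where E: "finite E" "E \<subseteq> Field \<tau>" "F = x ` E"
    using finite_subset_image[OF F(1,2)] by auto
  \<comment> \<open>\<open>e0\<close> guards against the case that no generator occurs.\<close>
  obtain e0 where e0: "e0 \<in> Field \<tau>" using inf by (metis ex_in_conv finite.emptyI)
  obtain m where m: "m \<in> insert e0 E" "\<And>a. a \<in> insert e0 E \<Longrightarrow> (a, m) \<in> \<tau>"
    using Well_order_finite_max[OF wo, of "insert e0 E"] E e0 by blast
  then obtain b where b: "b \<in> Field \<tau>" "m \<noteq> b" "(m, b) \<in> \<tau>"
    using infinite_Card_order_limit[OF card inf, of m] E e0 by blast
  have "E \<subseteq> underS \<tau> b"
    using m b wo
    unfolding underS_def well_order_on_def linear_order_on_def partial_order_on_def
      preorder_on_def trans_def antisym_def by blast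
  then have sub: "F \<subseteq> x ` underS \<tau> b" using E by auto
  have "h \<in> generate G (x ` underS \<tau> b)" if "h \<in> generate G F" for h
    using that by induction (use sub in \<open>auto intro: generate.intros\<close>)
  then show thesis using that b(1) F(3) by blast
qed

lemma infinite_disjoint_copies:
  assumes "infinite I"
  obtains I1 I2 where "I1 \<subseteq> I" "I2 \<subseteq> I" "I1 \<inter> I2 = {}" "|I| \<le>o |I1|" "|I| \<le>o |I2|"
proof -
  have "|I <+> I| \<le>o |I|"
    by (intro ordIso_imp_ordLeq card_of_Plus_infinite1 assms card_of_refl)
  then obtain f where f: "inj_on f (I <+> I)" "f ` (I <+> I) \<subseteq> I"
    unfolding card_of_ordLeq[symmetric] by (elim exE conjE)
  have inj: "inj_on (f \<circ> Inl) I" "inj_on (f \<circ> Inr) I"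
    using f(1) by (auto simp: inj_on_def)
  show thesis
  proof (rule that[of "(f \<circ> Inl) ` I" "(f \<circ> Inr) ` I"])
    show "(f \<circ> Inl) ` I \<subseteq> I" "(f \<circ> Inr) ` I \<subseteq> I" using f(2) by auto
    show "(f \<circ> Inl) ` I \<inter> (f \<circ> Inr) ` I = {}" using f(1) by (auto simp: inj_on_def)
    show "|I| \<le>o |(f \<circ> Inl) ` I|"
      using card_of_ordLeq[of I "(f \<circ> Inl) ` I"] inj(1) by blast
    show "|I| \<le>o |(f \<circ> Inr) ` I|"
      using card_of_ordLeq[of I "(f \<circ> Inr) ` I"] inj(2) by blast
  qed
qed

lemma (in comm_group) inj_on_hom_torus:
  assumes \<phi>: "\<And>i. i \<in> I \<Longrightarrow> \<phi> i \<in> hom G circle_group"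
    and sep: "\<And>g. g \<in> carrier G \<Longrightarrow> (\<And>i. i \<in> I \<Longrightarrow> \<phi> i g = \<one>\<^bsub>circle_group\<^esub>) \<Longrightarrow> g = \<one>"
  shows "inj_on (\<lambda>g. \<lambda>i\<in>I. \<phi> i g) (carrier G)"
proof -
  have "group (torus_group I)"
    using comm_group_circle_group by (simp add: torus_group_def comm_group_def)
  then have "inj_on (\<lambda>g. \<lambda>i\<in>I. \<phi> i g) (carrier G) \<longleftrightarrow>
      (\<forall>g. g \<in> carrier G \<longrightarrow> (\<lambda>i\<in>I. \<phi> i g) = \<one>\<^bsub>torus_group I\<^esub> \<longrightarrow> g = \<one>)"
    using hom_torus[of I \<phi>, OF \<phi>] by (intro inj_on_one_iff' is_group)
  also have "\<dots>"
  proof (intro allI impI)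
    fix g assume g: "g \<in> carrier G" and eq: "(\<lambda>i\<in>I. \<phi> i g) = \<one>\<^bsub>torus_group I\<^esub>"
    have "\<phi> i g = \<one>\<^bsub>circle_group\<^esub>" if "i \<in> I" for i
      using fun_cong[OF eq, of i] that by (simp add: torus_group_def)
    then show "g = \<one>" by (rule sep[OF g])
  qed
  finally show ?thesis .
qed

text \<open>The order of choices matters: \<open>x\<close> determines \<open>H\<close>, which
  determines cutoffs and prescribed characters; these give \<open>\<psi>\<close>, whose part on
  \<open>I1\<close> determines \<open>N\<close>. Only then is \<open>\<psi>\<close> altered on
  \<open>I2\<close>, with its values at all \<open>x b\<close> kept for density.\<close>

lemma (in comm_group) wide_dense_embedding:
  fixes \<tau> :: "'k rel" and S :: "'a set"
  defines "I \<equiv> two_pow \<tau>"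
  assumes \<tau>: "Cinfinite \<tau>" and S: "wide G \<tau> S"
    and card: "|carrier G| \<le>o ctwo ^c (ctwo ^c \<tau>)"
  shows "\<exists>\<pi>\<in>hom G (torus_group I). inj_on \<pi> (carrier G) \<and> dense_in (torus_topology I) (\<pi> ` S)"
proof -
  interpret divisible_target G circle_group
    by (rule divisible_target_circle) (rule comm_group_axioms)
  have inf: "infinite (Field \<tau>)" and co: "Card_order \<tau>"
    using \<tau> by (simp_all add: cinfinite_def)
  have card_I: "|Field \<tau>| \<le>o |I|"
  proof -
    have "|Field \<tau>| =o \<tau>" using co by (rule card_of_Field_ordIso)
    also have "\<tau> \<le>o ctwo ^c \<tau>" using ordLess_ctwo_cexp[OF co] by (rule ordLess_imp_ordLeq)
    also have "ctwo ^c \<tau> =o |I|"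
      unfolding I_def by (rule ordIso_symmetric[OF card_of_Field_ordIso[OF Card_order_cexp]])
    finally show ?thesis .
  qed
  then have I: "infinite I" using inf by (rule card_of_ordLeq_infinite)
  have card_Func: "|carrier G| \<le>o |Func I (UNIV :: bool set)|"
    using card unfolding I_def cexp_def[of ctwo "ctwo ^c \<tau>"] by (simp add: ctwo_def Field_card_of)
  obtain E where E: "E \<subseteq> hom G circle_group" "E \<noteq> {}" "|E| \<le>o |I|"
    and E_sep: "\<forall>y\<in>carrier G. (\<forall>\<phi>\<in>E. \<phi> y = \<one>\<^bsub>circle_group\<^esub>) \<longrightarrow> y = \<one>"
    by (rule few_separating_characters[OF I card_Func])
  obtain I1 I2 where I12: "I1 \<subseteq> I" "I2 \<subseteq> I" "I1 \<inter> I2 = {}" "|I| \<le>o |I1|" "|I| \<le>o |I2|"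
    using I by (rule infinite_disjoint_copies)
  obtain x where x: "x ` Field \<tau> \<subseteq> carrier G"
    and ext: "\<forall>c \<in> I \<rightarrow> Field \<tau>. \<forall>\<phi> \<in> I \<rightarrow> hom G circle_group. \<exists>\<psi> \<in> I \<rightarrow> hom G circle_group.
      (\<forall>i\<in>I. \<forall>b\<in>underS \<tau> (c i). \<psi> i (x b) = \<phi> i (x b)) \<and>
      (\<forall>\<rho> \<in> I \<rightarrow> hom G circle_group. (\<forall>i\<in>I. \<forall>b\<in>Field \<tau>. \<rho> i (x b) = \<psi> i (x b)) \<longrightarrow>
        dense_in (torus_topology I) ((\<lambda>g. \<lambda>i\<in>I. \<rho> i g) ` S))"
    by (rule wide_dense_characters[OF \<tau> S, folded I_def])
  define H where "H = generate G (x ` Field \<tau>)"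
  have H: "subgroup H G" unfolding H_def using x by (rule generate_is_subgroup)
  have HG: "h \<in> carrier G" if "h \<in> H" for h using H that by (rule subgroup.mem_carrier)
  have "|H| \<le>o |I1|"
    unfolding H_def
    by (intro ordLeq_transitive[OF card_of_generate_infinite[OF inf x]]
        ordLeq_transitive[OF card_I I12(4)])
  then obtain j where j: "inj_on j H" "j ` H \<subseteq> I1"
    unfolding card_of_ordLeq[symmetric] by (elim exE conjE)
  \<comment> \<open>A coordinate prescribed at every \<open>x b\<close> would have no room left for
    approximation. Being nontrivial at \<open>h\<close> costs only the segment below
    \<open>lev h\<close>.\<close>
  have "\<exists>a\<in>Field \<tau>. h \<in> generate G (x ` underS \<tau> a)" if "h \<in> H" for h
    using that unfolding H_def by (rule generate_image_underS[OF \<tau>]) blast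
  then obtain lev where lev: "\<And>h. h \<in> H \<Longrightarrow> lev h \<in> Field \<tau>"
    "\<And>h. h \<in> H \<Longrightarrow> h \<in> generate G (x ` underS \<tau> (lev h))" by metis
  have "\<exists>\<phi>\<in>hom G circle_group. h \<noteq> \<one> \<longrightarrow> \<phi> h \<noteq> \<one>\<^bsub>circle_group\<^esub>" if "h \<in> H" for h
    using E_sep HG[OF that] E(1,2) by blast
  then obtain chr where chr: "\<And>h. h \<in> H \<Longrightarrow> chr h \<in> hom G circle_group"
    "\<And>h. h \<in> H \<Longrightarrow> h \<noteq> \<one> \<Longrightarrow> chr h h \<noteq> \<one>\<^bsub>circle_group\<^esub>" by metis
  have one_H: "\<one> \<in> H" using H by (rule subgroup.one_closed)
  \<comment> \<open>Indices outside the image of \<open>j\<close> receive \<open>\<one>\<close>, so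
    that a cutoff and a character are available at every coordinate.\<close>
  define k where "k i = (if i \<in> j ` H then inv_into H j i else \<one>)" for i
  have k: "k i \<in> H" for i using one_H by (auto simp: k_def inv_into_into)
  have kj: "k (j h) = h" if "h \<in> H" for h using that j(1) by (simp add: k_def)
  obtain \<psi> where \<psi>: "\<And>i. i \<in> I \<Longrightarrow> \<psi> i \<in> hom G circle_group"
    "\<And>i b. i \<in> I \<Longrightarrow> b \<in> underS \<tau> (lev (k i)) \<Longrightarrow> \<psi> i (x b) = chr (k i) (x b)"
    and dense: "\<And>\<rho>. (\<And>i. i \<in> I \<Longrightarrow> \<rho> i \<in> hom G circle_group) \<Longrightarrow>
        (\<And>i b. i \<in> I \<Longrightarrow> b \<in> Field \<tau> \<Longrightarrow> \<rho> i (x b) = \<psi> i (x b)) \<Longrightarrow>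
        dense_in (torus_topology I) ((\<lambda>g. \<lambda>i\<in>I. \<rho> i g) ` S)"
  proof -
    have "(\<lambda>i. lev (k i)) \<in> I \<rightarrow> Field \<tau>" "(\<lambda>i. chr (k i)) \<in> I \<rightarrow> hom G circle_group"
      using lev(1) chr(1) k by auto
    from bspec[OF bspec[OF ext this(1)] this(2)] obtain \<psi> where
      "\<psi> \<in> I \<rightarrow> hom G circle_group"
      "\<forall>i\<in>I. \<forall>b\<in>underS \<tau> (lev (k i)). \<psi> i (x b) = chr (k i) (x b)"
      "\<forall>\<rho> \<in> I \<rightarrow> hom G circle_group. (\<forall>i\<in>I. \<forall>b\<in>Field \<tau>. \<rho> i (x b) = \<psi> i (x b)) \<longrightarrow>
        dense_in (torus_topology I) ((\<lambda>g. \<lambda>i\<in>I. \<rho> i g) ` S)"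
      by (elim bexE conjE)
    then show thesis by (intro that[of \<psi>]) auto
  qed
  have \<psi>_sep: "\<psi> (j h) h \<noteq> \<one>\<^bsub>circle_group\<^esub>" if h: "h \<in> H" "h \<noteq> \<one>" for h
  proof -
    have jh: "j h \<in> I" using h(1) j(2) I12(1) by auto
    have "x ` underS \<tau> (lev h) \<subseteq> carrier G" using x by (auto simp: underS_def Field_def)
    then have "\<psi> (j h) h = chr h h"
      by (rule hom_eq_on_generate[OF \<psi>(1)[OF jh] chr(1)[OF h(1)] _ _ lev(2)[OF h(1)]])
        (use \<psi>(2)[OF jh] kj[OF h(1)] in auto)
    then show ?thesis using chr(2) h by simp
  qed
  define N where "N = {g \<in> carrier G. \<forall>\<phi>\<in>\<psi> ` I1. \<phi> g = \<one>\<^bsub>circle_group\<^esub>}"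
  have N: "subgroup N G"
    unfolding N_def using \<psi>(1) I12(1) by (intro subgroup_common_kernel) auto
  have HN: "H \<inter> N \<subseteq> {\<one>}"
  proof
    fix h assume h: "h \<in> H \<inter> N"
    then have "\<psi> (j h) h = \<one>\<^bsub>circle_group\<^esub>" using j(2) by (auto simp: N_def)
    then show "h \<in> {\<one>}" using \<psi>_sep h by auto
  qed
  have "|E| \<le>o |I2|" using E(3) I12(5) by (rule ordLeq_transitive)
  then obtain e where e: "e ` I2 = E"
    using card_of_ordLeq2[OF E(2), of I2] by auto
  \<comment> \<open>Keeping \<open>\<psi> i\<close> on \<open>H\<close> preserves density;
    triviality of \<open>H \<inter> N\<close> leaves the values on \<open>N\<close> free to be those
    of \<open>e i\<close>.\<close>
  have "\<exists>\<rho>\<in>hom G circle_group. (\<forall>h\<in>H. \<rho> h = \<psi> i h) \<and> (\<forall>g\<in>N. \<rho> g = e i g)" if i: "i \<in> I2" for i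
  proof -
    have "\<psi> i \<in> hom G circle_group" "e i \<in> hom G circle_group"
      using i \<psi>(1) I12(2) e E(1) by auto
    then have "\<psi> i \<in> hom (G\<lparr>carrier := H\<rparr>) circle_group" "e i \<in> hom (G\<lparr>carrier := N\<rparr>) circle_group"
      using HG subgroup.mem_carrier[OF N] by (auto simp: hom_def Pi_iff)
    then obtain \<rho> where "\<rho> \<in> hom G circle_group" "\<And>h. h \<in> H \<Longrightarrow> \<rho> h = \<psi> i h"
      "\<And>g. g \<in> N \<Longrightarrow> \<rho> g = e i g"
      using hom_joint_extension[OF H _ N _ HN] by metis
    then show ?thesis by blast
  qed
  then obtain \<rho>' where \<rho>': "\<And>i. i \<in> I2 \<Longrightarrow> \<rho>' i \<in> hom G circle_group"
    "\<And>i h. i \<in> I2 \<Longrightarrow> h \<in> H \<Longrightarrow> \<rho>' i h = \<psi> i h"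
    "\<And>i g. i \<in> I2 \<Longrightarrow> g \<in> N \<Longrightarrow> \<rho>' i g = e i g" by metis
  define \<rho> where "\<rho> i = (if i \<in> I2 then \<rho>' i else \<psi> i)" for i
  have \<rho>: "\<rho> i \<in> hom G circle_group" if "i \<in> I" for i
    using that \<psi>(1) \<rho>'(1) by (simp add: \<rho>_def)
  have \<rho>_x: "\<rho> i (x b) = \<psi> i (x b)" if "i \<in> I" "b \<in> Field \<tau>" for i b
  proof -
    have "x b \<in> H" unfolding H_def using that(2) by (intro generate.incl) auto
    then show ?thesis using \<rho>'(2) by (simp add: \<rho>_def)
  qed
  \<comment> \<open>\<open>H\<close> and \<open>N\<close> need not generate \<open>G\<close>. A
    point killed by the coordinates in \<open>I1\<close> already lies in \<open>N\<close>, and there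
    the coordinates in \<open>I2\<close> run through all of the separating family
    \<open>E\<close>.\<close>
  have "g = \<one>" if g: "g \<in> carrier G" and \<rho>g: "\<And>i. i \<in> I \<Longrightarrow> \<rho> i g = \<one>\<^bsub>circle_group\<^esub>" for g
  proof (rule E_sep[rule_format, OF g])
    have "\<psi> i g = \<one>\<^bsub>circle_group\<^esub>" if "i \<in> I1" for i
    proof -
      have "i \<in> I" "i \<notin> I2" using that I12 by auto
      then show ?thesis using \<rho>g[of i] by (simp add: \<rho>_def)
    qed
    then have gN: "g \<in> N" using g by (auto simp: N_def)
    fix \<phi> assume "\<phi> \<in> E"
    then obtain i where "i \<in> I2" "\<phi> = e i" using e by auto
    then show "\<phi> g = \<one>\<^bsub>circle_group\<^esub>"
      using \<rho>'(3)[OF _ gN, of i] \<rho>g[of i] I12(2) by (auto simp: \<rho>_def)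
  qed
  then have "inj_on (\<lambda>g. \<lambda>i\<in>I. \<rho> i g) (carrier G)"
    using \<rho> by (intro inj_on_hom_torus) auto
  moreover have "(\<lambda>g. \<lambda>i\<in>I. \<rho> i g) \<in> hom G (torus_group I)" using \<rho> by (rule hom_torus)
  moreover have "dense_in (torus_topology I) ((\<lambda>g. \<lambda>i\<in>I. \<rho> i g) ` S)"
    using \<rho> \<rho>_x by (rule dense)
  ultimately show ?thesis by blast
qed

theorem corollary2p4:
  fixes \<tau> :: "'k rel" and G :: "('a, 'm) monoid_scheme" and S :: "'a set"
  assumes "Cinfinite \<tau>"
    and "comm_group G"
    and "wide G \<tau> S"
  shows "(\<exists>\<pi> \<in> hom G (torus_group (two_pow \<tau>)).
            dense_in (torus_topology (two_pow \<tau>)) (\<pi> ` S)) \<and>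
         ( |carrier G| \<le>o ctwo ^c (ctwo ^c \<tau>) \<longrightarrow>
            (\<exists>\<pi> \<in> hom G (torus_group (two_pow \<tau>)). inj_on \<pi> (carrier G) \<and>
              dense_in (torus_topology (two_pow \<tau>)) (\<pi> ` S)))"
proof (intro conjI impI)
  interpret comm_group G by (rule assms(2))
  interpret divisible_target G circle_group by (rule divisible_target_circle[OF assms(2)])
  obtain a0 where a0: "a0 \<in> Field \<tau>"
    using assms(1) by (metis cinfinite_def ex_in_conv finite.emptyI)
  obtain x where "x ` Field \<tau> \<subseteq> carrier G"
    and ext: "\<forall>c \<in> two_pow \<tau> \<rightarrow> Field \<tau>. \<forall>\<phi> \<in> two_pow \<tau> \<rightarrow> hom G circle_group. \<exists>\<psi> \<in> two_pow \<tau> \<rightarrow> hom G circle_group.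
      (\<forall>i\<in>two_pow \<tau>. \<forall>b\<in>underS \<tau> (c i). \<psi> i (x b) = \<phi> i (x b)) \<and>
      (\<forall>\<rho> \<in> two_pow \<tau> \<rightarrow> hom G circle_group. (\<forall>i\<in>two_pow \<tau>. \<forall>b\<in>Field \<tau>. \<rho> i (x b) = \<psi> i (x b)) \<longrightarrow>
        dense_in (torus_topology (two_pow \<tau>)) ((\<lambda>g. \<lambda>i\<in>two_pow \<tau>. \<rho> i g) ` S))"
    by (rule wide_dense_characters[OF assms(1,3)])
  \<comment> \<open>For density alone, trivial characters with a constant cutoff serve as the
    prescription, and \<open>\<psi>\<close> itself is taken for \<open>\<rho>\<close>.\<close>
  have "(\<lambda>_. a0) \<in> two_pow \<tau> \<rightarrow> Field \<tau>"
    "(\<lambda>_ _. \<one>\<^bsub>circle_group\<^esub>) \<in> two_pow \<tau> \<rightarrow> hom G circle_group"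
    using a0 trivial_hom by auto
  from bspec[OF bspec[OF ext this(1)] this(2)] obtain \<psi> where
    "\<psi> \<in> two_pow \<tau> \<rightarrow> hom G circle_group"
    "dense_in (torus_topology (two_pow \<tau>)) ((\<lambda>g. \<lambda>i\<in>two_pow \<tau>. \<psi> i g) ` S)"
    by blast
  then show "\<exists>\<pi>\<in>hom G (torus_group (two_pow \<tau>)). dense_in (torus_topology (two_pow \<tau>)) (\<pi> ` S)"
    using hom_torus[of "two_pow \<tau>" \<psi>] by (auto simp: Pi_iff)
next
  assume "|carrier G| \<le>o ctwo ^c (ctwo ^c \<tau>)"
  then show "\<exists>\<pi>\<in>hom G (torus_group (two_pow \<tau>)). inj_on \<pi> (carrier G) \<and>
      dense_in (torus_topology (two_pow \<tau>)) (\<pi> ` S)"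
    by (rule comm_group.wide_dense_embedding[OF assms(2,1,3)])
qed

end
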